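(* Suppose $A\in\mathcal{B}(\mathcal{H})$ and let $k\ge 2$ be a (finite) integer. Each of the following sets is equal to $\Omega_k(A)$: (a) $\bigcap\{\Omega_{k-1}(A+2e^{i\xi}\|A\|P): \xi\in[0,2\pi),\ P\in\mathcal{P}_1\}$; (b) $\bigcap\{\Omega_1(A+2e^{i\xi}\|A\|P): \xi\in[0,2\pi),\ P\in\mathcal{P}_{k-1}\}$.
   Context: $\mathcal{H}$ is a complex Hilbert space with $\dim\mathcal{H}\ge k$, and $\mathcal{B}(\mathcal{H})$ is the algebra of bounded linear operators on $\mathcal{H}$ with operator norm $\|\cdot\|$. $\mathcal{P}_r$ is the set of rank $r$ orthogonal projections in $\mathcal{B}(\mathcal{H})$. For a Hermitian matrix, $\lambda_m$ denotes its $m$-th largest eigenvalue; for a self-adjoint operator $H$ on $\mathcal{H}$ and a positive integer $m\le\dim\mathcal{H}$, $\lambda_m(H)=\sup\{\lambda_m(X^*HX): X:\mathbb{C}^m\to\mathcal{H},\ X^*X=I_m\}$. With $\mathrm{Re}(B)=(B+B^* )/2$, $$\Omega_m(B)=\bigcap_{\xi\in[0,2\pi)}\{\mu\in\mathbb{C}: \mathrm{Re}(e^{i\xi}\mu)\le\lambda_m(\mathrm{Re}(e^{i\xi}B))\}.$$ *)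

theory Defs
  imports
    "HOL-Analysis.Operator_Norm"
    "Jordan_Normal_Form.Char_Poly"
    "HOL-Library.Multiset"
begin

text \<open>The inner product is conjugate-linear in its first argument.  Positive definiteness
  follows from the norm axioms of \<^class>\<open>banach\<close> together with \<open>cinner_self\<close>, which says that
  the norm is the one induced by the inner product.\<close>

class complex_hilbert_space = banach +
  fixes scaleC :: "complex \<Rightarrow> 'a \<Rightarrow> 'a" (infixr "*\<^sub>C" 75)
    and cinner :: "'a \<Rightarrow> 'a \<Rightarrow> complex"
  assumes scaleC_add_right: "c *\<^sub>C (x + y) = c *\<^sub>C x + c *\<^sub>C y"
    and scaleC_add_left: "(c + d) *\<^sub>C x = c *\<^sub>C x + d *\<^sub>C x"
    and scaleC_scaleC: "c *\<^sub>C (d *\<^sub>C x) = (c * d) *\<^sub>C x"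
    and scaleC_one: "1 *\<^sub>C x = x"
    and scaleC_of_real: "complex_of_real r *\<^sub>C x = r *\<^sub>R x"
    and cinner_commute: "cinner y x = cnj (cinner x y)"
    and cinner_add_right: "cinner x (y + z) = cinner x y + cinner x z"
    and cinner_scaleC_right: "cinner x (c *\<^sub>C y) = c * cinner x y"
    and cinner_self: "cinner x x = complex_of_real ((norm x)\<^sup>2)"

global_interpretation complex_vector:
  vector_space "scaleC :: complex \<Rightarrow> 'a \<Rightarrow> 'a :: complex_hilbert_space"
  defines cdependent = complex_vector.dependent
    and cspan = complex_vector.span
  by unfold_locales (simp_all add: scaleC_add_right scaleC_add_left scaleC_scaleC scaleC_one)

text \<open>Dimension and rank are expressed by exhibiting finite independent sets, since the library's
  \<open>dim\<close> takes the value 0 on infinite-dimensional spaces.\<close>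

definition cdim_ge :: "'a::complex_hilbert_space itself \<Rightarrow> nat \<Rightarrow> bool" where
  "cdim_ge _ n \<longleftrightarrow> (\<exists>S :: 'a set. finite S \<and> card S = n \<and> \<not> cdependent S)"

definition has_rank :: "('a::complex_hilbert_space \<Rightarrow> 'a) \<Rightarrow> nat \<Rightarrow> bool" where
  "has_rank T r \<longleftrightarrow> (\<exists>S. finite S \<and> card S = r \<and> \<not> cdependent S \<and> cspan S = range T)"

definition bounded_clinear :: "('a::complex_hilbert_space \<Rightarrow> 'a) \<Rightarrow> bool" where
  "bounded_clinear T \<longleftrightarrow> bounded_linear T \<and> (\<forall>c x. T (c *\<^sub>C x) = c *\<^sub>C T x)"

definition cadjoint :: "('a::complex_hilbert_space \<Rightarrow> 'a) \<Rightarrow> 'a \<Rightarrow> 'a" where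
  "cadjoint T = (THE T'. \<forall>x y. cinner (T x) y = cinner x (T' y))"

definition Re_op :: "('a::complex_hilbert_space \<Rightarrow> 'a) \<Rightarrow> 'a \<Rightarrow> 'a" where
  "Re_op B = (\<lambda>x. (B x + cadjoint B x) /\<^sub>R 2)"

definition projections :: "nat \<Rightarrow> ('a::complex_hilbert_space \<Rightarrow> 'a) set" where
  "projections r = {P. bounded_clinear P \<and> P \<circ> P = P \<and> cadjoint P = P \<and> has_rank P r}"

text \<open>The \<open>m\<close>-th largest eigenvalue of a Hermitian matrix, counted with multiplicity (\<open>m \<ge> 1\<close>).
  The eigenvalues are real, so taking real parts only changes their type.\<close>

definition eigval_desc :: "complex mat \<Rightarrow> nat \<Rightarrow> real" where
  "eigval_desc M m =
     rev (sorted_list_of_multiset (image_mset Re (proots (char_poly M)))) ! (m - 1)"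

text \<open>Linear maps \<open>X\<close> from \<open>\<complex>\<^sup>m\<close> to the Hilbert space are functions on \<open>carrier_vec m\<close>.
  The adjoint is given in coordinates by
  \<open>(X\<^sup>* h)\<^sub>i = \<langle>e\<^sub>i, X\<^sup>* h\<rangle> = \<langle>X e\<^sub>i, h\<rangle>\<close>.\<close>

definition clinear_from :: "nat \<Rightarrow> (complex vec \<Rightarrow> 'a::complex_hilbert_space) \<Rightarrow> bool" where
  "clinear_from m X \<longleftrightarrow>
     (\<forall>u \<in> carrier_vec m. \<forall>v \<in> carrier_vec m. X (u + v) = X u + X v) \<and>
     (\<forall>c. \<forall>v \<in> carrier_vec m. X (c \<cdot>\<^sub>v v) = c *\<^sub>C X v)"

definition adjoint_from ::
    "nat \<Rightarrow> (complex vec \<Rightarrow> 'a::complex_hilbert_space) \<Rightarrow> 'a \<Rightarrow> complex vec" where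
  "adjoint_from m X h = vec m (\<lambda>i. cinner (X (unit_vec m i)) h)"

definition matrix_of :: "nat \<Rightarrow> (complex vec \<Rightarrow> complex vec) \<Rightarrow> complex mat" where
  "matrix_of m f = mat m m (\<lambda>(i, j). f (unit_vec m j) $ i)"

definition lambda_op :: "nat \<Rightarrow> ('a::complex_hilbert_space \<Rightarrow> 'a) \<Rightarrow> real" where
  "lambda_op m H =
     Sup {eigval_desc (matrix_of m (adjoint_from m X \<circ> H \<circ> X)) m | X.
            clinear_from m X \<and> matrix_of m (adjoint_from m X \<circ> X) = 1\<^sub>m m}"

definition Omega :: "nat \<Rightarrow> ('a::complex_hilbert_space \<Rightarrow> 'a) \<Rightarrow> complex set" where
  "Omega m B =
     (\<Inter>\<xi> \<in> {0..<2 * pi}.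
        {\<mu>. Re (cis \<xi> * \<mu>) \<le> lambda_op m (Re_op (\<lambda>x. cis \<xi> *\<^sub>C B x))})"

end

theory Submission
  imports
    Defs
    "HOL-Analysis.Elementary_Topology"
    "HOL-Computational_Algebra.Fundamental_Theorem_Algebra"
    "Jordan_Normal_Form.Determinant"
begin

text \<open>Everything is read off from the quadratic form \<open>q\<^sub>H x = Re \<langle>x, H x\<rangle>\<close> of a
  self-adjoint \<open>H\<close>.  By the Courant--Fischer principle (\<open>lambda_op_ge\<close>, \<open>lambda_op_le\<close>),
  \<open>\<lambda>\<^sub>m(H)\<close> is the supremum over \<open>m\<close>-dimensional subspaces of the minimum of \<open>q\<^sub>H\<close>
  on the unit sphere of the subspace.

  One inclusion is a dimension count.  If \<open>P\<close> has rank \<open>r\<close>, a subspace of dimension \<open>r + m\<close> meets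
  the kernel of \<open>P\<close> in dimension at least \<open>m\<close>, and there a multiple of \<open>P\<close> added to \<open>H\<close> is
  invisible.  Hence \<open>\<lambda>\<^sub>r\<^sub>+\<^sub>m(H) \<le> \<lambda>\<^sub>m(H + c P)\<close>
  (\<open>lambda_op_le_lambda_op_drop\<close>) for every rotation of \<open>A\<close>, so that \<open>\<Omega>\<^sub>k(A)\<close> lies in both
  intersections (\<open>Omega_subset_Omega_perturbed\<close>).

  Conversely, let \<open>\<mu>\<close> be outside \<open>\<Omega>\<^sub>k(A)\<close>.  Then \<open>Re(e\<^sup>i\<^sup>\<eta> \<mu>) > \<lambda>\<^sub>k(H)\<close> for some
  \<open>\<eta>\<close>, with \<open>H = Re(e\<^sup>i\<^sup>\<eta> A)\<close>.  Choosing \<open>\<xi>\<close> opposite to \<open>\<eta>\<close> turns the perturbation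
  into \<open>H - 2\<parallel>A\<parallel>P\<close>.  In finite dimension one would take for \<open>P\<close> the projection onto the span of
  the top \<open>k - 1\<close> eigenvectors of \<open>H\<close>: their eigenvalues are moved to at most \<open>-\<parallel>A\<parallel>\<close>, and the
  largest one left is \<open>\<lambda>\<^sub>k(H)\<close>.  In infinite dimension \<open>H\<close> need not have eigenvectors, but
  almost maximizing vectors of \<open>q\<^sub>H\<close>, chosen greedily, serve as well: positivity of
  \<open>sup q\<^sub>H - H\<close> makes them almost eigenvectors
  (\<open>almost_maximal_orthonormal_family\<close>).  This gives
  \<open>\<lambda>\<^sub>1(H - 2\<parallel>A\<parallel>P) \<le> \<lambda>\<^sub>k(H) + \<epsilon>\<close> for a projection \<open>P\<close> of rank \<open>k - 1\<close>
  (\<open>deflation_by_projection\<close>), which excludes \<open>\<mu>\<close> from the second intersection.  If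
  \<open>P\<^sub>1 \<le> P\<close> has rank one, then \<open>P - P\<^sub>1\<close> has rank \<open>k - 2\<close>, and the dimension count gives
  \<open>\<lambda>\<^sub>k\<^sub>-\<^sub>1(H - 2\<parallel>A\<parallel>P\<^sub>1) \<le> \<lambda>\<^sub>1(H - 2\<parallel>A\<parallel>P)\<close>; this excludes \<open>\<mu>\<close> from the first.\<close>

section \<open>Calculus with the inner product\<close>

lemma cinner_scaleC_left: "cinner (c *\<^sub>C x) y = cnj c * cinner x y"
  for x :: "'a::complex_hilbert_space"
  by (metis cinner_commute cinner_scaleC_right complex_cnj_mult)

lemma cinner_add_left: "cinner (x + y) z = cinner x z + cinner y z"
  for x :: "'a::complex_hilbert_space"
  by (metis cinner_commute cinner_add_right complex_cnj_add)

lemma scaleC_scaleR: "r *\<^sub>R x = complex_of_real r *\<^sub>C x" for x :: "'a::complex_hilbert_space"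
  by (simp add: scaleC_of_real)

lemma scaleC_minus1: "- x = (-1) *\<^sub>C x" for x :: "'a::complex_hilbert_space"
  using scaleC_of_real[of "-1" x] by simp

lemma cinner_minus_right [simp]: "cinner x (- y) = - cinner x y" for x :: "'a::complex_hilbert_space"
  by (metis scaleC_minus1 cinner_scaleC_right mult_minus1)

lemma cinner_minus_left [simp]: "cinner (- x) y = - cinner x y" for x :: "'a::complex_hilbert_space"
  by (metis scaleC_minus1 cinner_scaleC_left mult_minus1 complex_cnj_minus complex_cnj_one)

lemma cinner_diff_right: "cinner x (y - z) = cinner x y - cinner x z"
  for x :: "'a::complex_hilbert_space"
  by (simp only: diff_conv_add_uminus cinner_add_right cinner_minus_right)

lemma cinner_scaleR_right [simp]: "cinner x (r *\<^sub>R y) = complex_of_real r * cinner x y"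
  for x :: "'a::complex_hilbert_space"
  by (simp only: scaleC_scaleR cinner_scaleC_right)

lemma cinner_scaleR_left [simp]: "cinner (r *\<^sub>R x) y = complex_of_real r * cinner x y"
  for x :: "'a::complex_hilbert_space"
  by (simp only: scaleC_scaleR cinner_scaleC_left) simp

lemma cinner_zero_right [simp]: "cinner x 0 = 0" for x :: "'a::complex_hilbert_space"
  using cinner_add_right[of x 0 0] by simp

lemma cinner_zero_left [simp]: "cinner 0 x = 0" for x :: "'a::complex_hilbert_space"
  using cinner_add_left[of 0 0 x] by simp

lemma scaleC_zero_left [simp]: "0 *\<^sub>C x = 0" for x :: "'a::complex_hilbert_space"
  by (rule complex_vector.scale_zero_left)

lemma scaleC_zero_right [simp]: "c *\<^sub>C (0 :: 'a) = 0" for x :: "'a::complex_hilbert_space"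
  by (rule complex_vector.scale_zero_right)

lemma cinner_sum_right: "cinner x (\<Sum>i\<in>I. f i) = (\<Sum>i\<in>I. cinner x (f i))"
  for x :: "'a::complex_hilbert_space"
  by (induction I rule: infinite_finite_induct) (simp_all add: cinner_add_right)

lemma cinner_sum_left: "cinner (\<Sum>i\<in>I. f i) x = (\<Sum>i\<in>I. cinner (f i) x)"
  for x :: "'a::complex_hilbert_space"
  by (induction I rule: infinite_finite_induct) (simp_all add: cinner_add_left)

lemma Re_cinner_self [simp]: "Re (cinner x x) = (norm x)\<^sup>2" for x :: "'a::complex_hilbert_space"
  by (simp add: cinner_self)

lemma Re_cinner_commute: "Re (cinner x y) = Re (cinner y x)" for x :: "'a::complex_hilbert_space"
  by (subst cinner_commute) simp

lemma cinner_eq_zero_sym: "cinner x y = 0 \<longleftrightarrow> cinner y x = 0" for x :: "'a::complex_hilbert_space"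
  by (metis cinner_commute complex_cnj_zero)

lemma cinner_ext: "(\<And>x. cinner x y = cinner x z) \<Longrightarrow> y = z" for y :: "'a::complex_hilbert_space"
proof -
  assume "\<And>x. cinner x y = cinner x z"
  then have "cinner (y - z) (y - z) = 0" by (simp add: cinner_diff_right)
  then show ?thesis by (simp add: cinner_self)
qed

lemma norm_scaleC: "norm (c *\<^sub>C x) = cmod c * norm x" for x :: "'a::complex_hilbert_space"
proof -
  have "cinner (c *\<^sub>C x) (c *\<^sub>C x) = (c * cnj c) * cinner x x"
    by (simp add: cinner_scaleC_left cinner_scaleC_right)
  also have "\<dots> = complex_of_real ((cmod c)\<^sup>2 * (norm x)\<^sup>2)"
    by (simp only: of_real_mult cinner_self[of x] complex_norm_square[of c])
  finally have "(norm (c *\<^sub>C x))\<^sup>2 = (cmod c * norm x)\<^sup>2"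
    by (simp only: cinner_self of_real_eq_iff power_mult_distrib)
  then show ?thesis by (simp add: power2_eq_iff_nonneg)
qed

lemma norm_add_square: "(norm (x + y))\<^sup>2 = (norm x)\<^sup>2 + 2 * Re (cinner x y) + (norm y)\<^sup>2"
  for x :: "'a::complex_hilbert_space"
  unfolding Re_cinner_self[symmetric]
  by (simp add: cinner_add_left cinner_add_right Re_cinner_commute[of y x] del: Re_cinner_self)

lemma bounded_clinear_add: "bounded_clinear T \<Longrightarrow> T (x + y) = T x + T y"
  by (simp add: bounded_clinear_def bounded_linear.linear linear_add linear_0)

lemma bounded_clinear_scaleC: "bounded_clinear T \<Longrightarrow> T (c *\<^sub>C x) = c *\<^sub>C T x"
  by (simp add: bounded_clinear_def)

lemma bounded_clinear_zero: "bounded_clinear T \<Longrightarrow> T 0 = 0"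
  by (simp add: bounded_clinear_def bounded_linear.linear linear_add linear_0)

lemma bounded_clinear_bound:
  "bounded_clinear T \<Longrightarrow> norm (T x) \<le> onorm T * norm x"
  by (simp add: bounded_clinear_def onorm)

lemma bounded_clinear_sum:
  "bounded_clinear T \<Longrightarrow> T (\<Sum>i\<in>I. f i) = (\<Sum>i\<in>I. T (f i))"
  by (simp add: bounded_clinear_def bounded_linear.linear linear_sum)

lemma bounded_linear_scaleC: "bounded_linear (\<lambda>x. c *\<^sub>C x :: 'a::complex_hilbert_space)"
  by (rule bounded_linear_intro[of _ "cmod c"])
    (simp_all add: scaleC_add_right scaleC_scaleR scaleC_scaleC norm_scaleC mult.commute)

lemma bounded_clinearI:
  assumes "\<And>x y. T (x + y) = T x + T y" "\<And>c x. T (c *\<^sub>C x) = c *\<^sub>C T x"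
    and "\<And>x. norm (T x) \<le> C * norm x"
  shows "bounded_clinear T"
  unfolding bounded_clinear_def
proof safe
  show "bounded_linear T"
    by (rule bounded_linear_intro[of _ C])
      (simp_all add: assms(1,2) scaleC_scaleR, metis assms(3) mult.commute)
qed (simp add: assms(2))

lemma bounded_clinear_plus_scaleC:
  assumes "bounded_clinear S" "bounded_clinear T"
  shows "bounded_clinear (\<lambda>x. S x + c *\<^sub>C T x)"
  using assms unfolding bounded_clinear_def
  by (auto intro!: bounded_linear_add bounded_linear_compose[OF bounded_linear_scaleC]
      simp: scaleC_add_right scaleC_scaleC mult.commute)

lemma bounded_clinear_scaleC_comp:
  "bounded_clinear T \<Longrightarrow> bounded_clinear (\<lambda>x. c *\<^sub>C T x)"
  unfolding bounded_clinear_def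
  by (auto intro!: bounded_linear_compose[OF bounded_linear_scaleC]
      simp: scaleC_add_right scaleC_scaleC mult.commute)

section \<open>Self-adjoint operators and their quadratic forms\<close>

definition selfadjoint :: "('a::complex_hilbert_space \<Rightarrow> 'a) \<Rightarrow> bool" where
  "selfadjoint H \<longleftrightarrow> bounded_clinear H \<and> (\<forall>x y. cinner (H x) y = cinner x (H y))"

definition qform :: "('a::complex_hilbert_space \<Rightarrow> 'a) \<Rightarrow> 'a \<Rightarrow> real" where
  "qform H x = Re (cinner x (H x))"

lemma selfadjoint_bounded_clinear: "selfadjoint H \<Longrightarrow> bounded_clinear H"
  by (simp add: selfadjoint_def)

lemma selfadjoint_sym: "selfadjoint H \<Longrightarrow> cinner (H x) y = cinner x (H y)"
  by (simp add: selfadjoint_def)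

lemma selfadjoint_commute: "selfadjoint H \<Longrightarrow> cinner y (H x) = cnj (cinner x (H y))"
  by (metis selfadjoint_sym cinner_commute)

lemma qform_scaleC: "bounded_clinear H \<Longrightarrow> qform H (c *\<^sub>C x) = (cmod c)\<^sup>2 * qform H x"
proof -
  assume "bounded_clinear H"
  then have "cinner (c *\<^sub>C x) (H (c *\<^sub>C x)) = (c * cnj c) * cinner x (H x)"
    by (simp add: bounded_clinear_scaleC cinner_scaleC_left cinner_scaleC_right)
  also have "c * cnj c = complex_of_real ((cmod c)\<^sup>2)"
    by (rule complex_norm_square[symmetric])
  finally show ?thesis by (simp add: qform_def del: of_real_power)
qed

lemma qform_add:
  assumes "selfadjoint H"
  shows "qform H (x + y) = qform H x + 2 * Re (cinner x (H y)) + qform H y"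
  using selfadjoint_commute[OF assms, of y x]
  by (simp add: qform_def bounded_clinear_add[OF selfadjoint_bounded_clinear[OF assms]]
      cinner_add_left cinner_add_right)

lemma selfadjoint_id: "selfadjoint (\<lambda>x. x)"
  by (auto simp: selfadjoint_def bounded_clinear_def)

lemma qform_id [simp]: "qform (\<lambda>x. x) x = (norm x)\<^sup>2"
  by (simp add: qform_def)

lemma selfadjoint_shift:
  assumes "selfadjoint H"
  shows "selfadjoint (\<lambda>x. s *\<^sub>R x + t *\<^sub>R H x)"
proof -
  have "bounded_clinear (\<lambda>x. (complex_of_real s *\<^sub>C x) + complex_of_real t *\<^sub>C H x)"
    using assms selfadjoint_id
    by (intro bounded_clinear_plus_scaleC bounded_clinear_scaleC_comp selfadjoint_bounded_clinear)
  then show ?thesis using assms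
    by (simp add: selfadjoint_def scaleC_of_real cinner_add_left cinner_add_right)
qed

lemma qform_shift: "qform (\<lambda>x. s *\<^sub>R x + t *\<^sub>R H x) x = s * (norm x)\<^sup>2 + t * qform H x"
  by (simp add: qform_def cinner_add_right)

text \<open>The discriminant inequality with the square of \<open>b\<close> already divided out.  The shape
  \<open>b * c\<close> of the leading coefficient is what the substitution of \<open>- t b y\<close> into a Hermitian form
  produces, and it lets the degenerate case \<open>c = 0\<close> through.\<close>

lemma nonneg_quadratic_discriminant:
  fixes a b c :: real
  assumes "\<And>t. 0 \<le> a - 2 * t * b + t\<^sup>2 * (b * c)" "0 \<le> b" "0 \<le> c"
  shows "b \<le> a * c"
proof (cases "c = 0")
  case True
  have "b = 0"
  proof (rule ccontr)
    assume "b \<noteq> 0"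
    moreover have "0 \<le> a - 2 * ((a + 1) / b) * b" using assms(1)[of "(a + 1) / b"] True by simp
    moreover have "0 \<le> a" using assms(1)[of 0] by simp
    ultimately show False by simp
  qed
  then show ?thesis using True by simp
next
  case False
  then show ?thesis using assms(1)[of "1 / c"] assms(3)
    by (simp add: field_simps power2_eq_square)
qed

text \<open>The Cauchy--Schwarz inequality for the form of \<open>G\<close>, with positivity demanded only on the complex
  plane spanned by \<open>x\<close> and \<open>y\<close>.  It has three uses: with \<open>G\<close> the identity it is the usual
  inequality; with \<open>qform G x = 0\<close> it shows that minimizers of the form are eigenvectors; with
  \<open>qform G x\<close> small it shows that almost maximal vectors are almost eigenvectors.\<close>

lemma psd_cauchy_schwarz:
  assumes G: "selfadjoint G"
    and pos: "\<And>c. 0 \<le> qform G (x + c *\<^sub>C y)" and y: "0 \<le> qform G y"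
  shows "(cmod (cinner y (G x)))\<^sup>2 \<le> qform G x * qform G y"
proof (rule nonneg_quadratic_discriminant)
  fix t :: real
  let ?b = "cinner y (G x)"
  have G': "bounded_clinear G" using G by (rule selfadjoint_bounded_clinear)
  have *: "cinner x (G y) = cnj ?b" using selfadjoint_commute[OF G] by blast
  have "qform G (x + (- of_real t * ?b) *\<^sub>C y)
      = qform G x + 2 * Re ((- of_real t * ?b) * cnj ?b) + (cmod (- of_real t * ?b))\<^sup>2 * qform G y"
    by (simp only: qform_add[OF G] qform_scaleC[OF G'] bounded_clinear_scaleC[OF G']
        cinner_scaleC_right *)
  also have "Re ((- of_real t * ?b) * cnj ?b) = - t * (cmod ?b)\<^sup>2"
    by (simp add: mult.assoc complex_mult_cnj cmod_power2)
  finally show "0 \<le> qform G x - 2 * t * (cmod ?b)\<^sup>2 + t\<^sup>2 * ((cmod ?b)\<^sup>2 * qform G y)"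
    using pos[of "- of_real t * ?b"] by (simp add: norm_mult power_mult_distrib algebra_simps)
qed (use y in simp_all)

lemma cauchy_schwarz: "cmod (cinner x y) \<le> norm x * norm y" for x :: "'a::complex_hilbert_space"
  using psd_cauchy_schwarz[OF selfadjoint_id, of y x]
  by (simp add: power_mult_distrib[symmetric] power2_le_iff_abs_le mult.commute)

lemma abs_qform_le:
  assumes "bounded_clinear H"
  shows "\<bar>qform H x\<bar> \<le> onorm H * (norm x)\<^sup>2"
proof -
  have "\<bar>qform H x\<bar> \<le> norm x * norm (H x)"
    unfolding qform_def using abs_Re_le_cmod cauchy_schwarz order_trans by blast
  also have "\<dots> \<le> norm x * (onorm H * norm x)"
    using bounded_clinear_bound[OF assms] by (simp add: mult_left_mono)
  finally show ?thesis by (simp add: power2_eq_square mult_ac)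
qed

section \<open>Adjoints exist\<close>

text \<open>The midpoint form of the law is the one that makes minimizing sequences of a uniformly convex
  functional Cauchy sequences.\<close>

lemma parallelogram_law:
  "(norm (x - y))\<^sup>2 = 2 * (norm x)\<^sup>2 + 2 * (norm y)\<^sup>2 - 4 * (norm ((1/2) *\<^sub>R (x + y)))\<^sup>2"
  for x :: "'a::complex_hilbert_space"
proof -
  have "(norm (x - y))\<^sup>2 = (norm x)\<^sup>2 - 2 * Re (cinner x y) + (norm y)\<^sup>2"
    using norm_add_square[of x "- y"] by simp
  moreover have "(norm ((1/2) *\<^sub>R (x + y)))\<^sup>2 = (norm (x + y))\<^sup>2 / 4"
    by (simp add: power_divide del: scaleR_add_right)
  ultimately show ?thesis using norm_add_square[of x y] by simp
qed

lemma linear_part_vanishes: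
  fixes a b :: real
  assumes "\<And>t. 0 \<le> 2 * t * b + t\<^sup>2 * a"
  shows "b = 0"
proof -
  have "b\<^sup>2 \<le> 0 * \<bar>a\<bar>"
  proof (rule nonneg_quadratic_discriminant)
    fix t :: real
    have "0 \<le> 2 * (- t * b) * b + (- t * b)\<^sup>2 * a" by (rule assms)
    also have "\<dots> \<le> 2 * (- t * b) * b + (- t * b)\<^sup>2 * \<bar>a\<bar>"
      by (intro add_left_mono mult_left_mono) simp_all
    finally show "0 \<le> 0 - 2 * t * b\<^sup>2 + t\<^sup>2 * (b\<^sup>2 * \<bar>a\<bar>)"
      by (simp add: power2_eq_square mult_ac)
  qed simp_all
  then show ?thesis by simp
qed

text \<open>The representing vector minimizes \<open>\<parallel>x\<parallel>\<^sup>2 - 2 Re (f x)\<close>.  The functional is bounded below,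
  its minimizing sequences are Cauchy by the parallelogram law, and the first variation at the
  minimum vanishes, which says \<open>Re \<langle>z, y\<rangle> = Re (f y)\<close>; the imaginary parts follow by
  replacing \<open>y\<close> with \<open>\<i> y\<close>.\<close>

lemma riesz_representation:
  fixes f :: "'a::complex_hilbert_space \<Rightarrow> complex"
  assumes add: "\<And>x y. f (x + y) = f x + f y" and scale: "\<And>c x. f (c *\<^sub>C x) = c * f x"
    and bound: "\<And>x. cmod (f x) \<le> C * norm x"
  shows "\<exists>z. \<forall>x. cinner z x = f x"
proof -
  define J where "J = (\<lambda>x. (norm x)\<^sup>2 - 2 * Re (f x))"
  have lin: "bounded_linear f"
    by (rule bounded_linear_intro[of _ C])
      (simp_all add: add scaleC_scaleR scale, simp add: scaleR_conv_of_real, metis bound mult.commute)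
  have half: "Re (f ((1/2) *\<^sub>R x)) = Re (f x) / 2" for x
    by (simp add: scaleC_scaleR scale)
  have Jbelow: "- (C\<^sup>2) \<le> J x" for x
  proof -
    have "Re (f x) \<le> C * norm x" using bound[of x] complex_Re_le_cmod order_trans by blast
    moreover have "0 \<le> (norm x - C)\<^sup>2" by simp
    ultimately show ?thesis by (simp add: J_def power2_diff mult.commute)
  qed
  define d where "d = (INF x. J x)"
  have bdd: "bdd_below (range J)" using Jbelow by (intro bdd_belowI[of _ "- (C\<^sup>2)"]) auto
  have dle: "d \<le> J x" for x unfolding d_def by (rule cINF_lower[OF bdd]) simp
  have "\<exists>x. J x < d + 1 / Suc n" for n
    using cINF_less_iff[OF _ bdd, of "d + 1 / Suc n"] unfolding d_def by simp
  then obtain X where X: "\<And>n. J (X n) < d + 1 / Suc n" by metis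
  have gap: "(norm (x - y))\<^sup>2 \<le> 2 * (J x - d) + 2 * (J y - d)" for x y
    using dle[of "(1/2) *\<^sub>R (x + y)"] parallelogram_law[of x y]
    unfolding J_def by (simp only: half add plus_complex.sel) argo
  have "Cauchy X"
  proof (rule metric_CauchyI)
    fix e :: real assume "0 < e"
    then obtain M where M: "1 / Suc M < e\<^sup>2 / 4"
      using nat_approx_posE[of "e\<^sup>2 / 4"] by (auto simp: field_simps)
    show "\<exists>M. \<forall>m\<ge>M. \<forall>n\<ge>M. dist (X m) (X n) < e"
    proof (intro exI allI impI)
      fix m n assume mn: "m \<ge> M" "n \<ge> M"
      have *: "J (X j) - d < e\<^sup>2 / 4" if "j \<ge> M" for j
      proof -
        have "1 / real (Suc j) \<le> 1 / Suc M" using that by (simp add: field_simps)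
        then show ?thesis using X[of j] M by linarith
      qed
      have "(norm (X m - X n))\<^sup>2 < e\<^sup>2"
        using gap[of "X m" "X n"] *[OF mn(1)] *[OF mn(2)] by simp
      then show "dist (X m) (X n) < e"
        using \<open>0 < e\<close> by (simp add: dist_norm power_less_imp_less_base[of _ 2])
    qed
  qed
  then obtain z where z: "X \<longlonglongrightarrow> z" using Cauchy_convergent convergent_def by blast
  have "(\<lambda>n. J (X n)) \<longlonglongrightarrow> J z"
    unfolding J_def by (intro tendsto_intros z bounded_linear.tendsto[OF lin])
  moreover have "(\<lambda>n. d + 1 / Suc n) \<longlonglongrightarrow> d + 0"
    by (intro tendsto_intros) (use LIMSEQ_inverse_real_of_nat in \<open>simp add: inverse_eq_divide\<close>)
  ultimately have "J z \<le> d + 0"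
    by (rule LIMSEQ_le) (use X less_imp_le in blast)
  then have Jz: "J z \<le> J x" for x using dle[of x] by simp
  have re: "Re (cinner z y) = Re (f y)" for y
  proof -
    have "Re (cinner z y) - Re (f y) = 0"
    proof (rule linear_part_vanishes)
      fix t :: real
      have "f (z + t *\<^sub>R y) = f z + of_real t * f y" by (simp add: add scaleC_scaleR scale)
      then show "0 \<le> 2 * t * (Re (cinner z y) - Re (f y)) + t\<^sup>2 * (norm y)\<^sup>2"
        using Jz[of "z + t *\<^sub>R y"]
        by (simp add: J_def norm_add_square power_mult_distrib algebra_simps)
    qed
    then show ?thesis by simp
  qed
  have "cinner z x = f x" for x
    using re[of x] re[of "\<i> *\<^sub>C x"] by (simp add: complex_eq_iff cinner_scaleC_right scale)
  then show ?thesis by blast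
qed

lemma cadjoint_eqI:
  assumes "\<And>x y. cinner (T x) y = cinner x (S y)"
  shows "cadjoint T = S"
  unfolding cadjoint_def
proof (rule the_equality)
  show "\<forall>x y. cinner (T x) y = cinner x (S y)" using assms by blast
  fix S' assume S': "\<forall>x y. cinner (T x) y = cinner x (S' y)"
  show "S' = S" by (rule ext, rule cinner_ext) (use S' assms in simp)
qed

text \<open>The operator \<open>cadjoint T\<close> is a definite description; the Riesz representation of the functionals
  \<open>x \<mapsto> \<langle>y, T x\<rangle>\<close> shows that it denotes.\<close>

lemma cinner_cadjoint:
  assumes "bounded_clinear T"
  shows "cinner (T x) y = cinner x (cadjoint T y)"
proof -
  have "\<exists>z. \<forall>x. cinner z x = cinner y (T x)" for y
  proof (rule riesz_representation)
    fix x
    have "cmod (cinner y (T x)) \<le> norm y * (onorm T * norm x)"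
      using cauchy_schwarz bounded_clinear_bound[OF assms]
      by (meson mult_left_mono norm_ge_zero order_trans)
    then show "cmod (cinner y (T x)) \<le> (norm y * onorm T) * norm x" by (simp add: mult_ac)
  qed (simp_all add: assms bounded_clinear_add bounded_clinear_scaleC cinner_add_right
      cinner_scaleC_right)
  then obtain S where "\<And>x y. cinner (S y) x = cinner y (T x)" by metis
  then have S: "cinner (T x) y = cinner x (S y)" for x y by (metis cinner_commute)
  then show ?thesis using cadjoint_eqI[of T S] by simp
qed

lemma cinner_Re_op:
  assumes "bounded_clinear B"
  shows "cinner x (Re_op B y) = (cinner x (B y) + cinner (B x) y) / 2"
  by (simp add: Re_op_def cinner_add_right cinner_cadjoint[OF assms])

lemma qform_Re_op:
  assumes "bounded_clinear B"
  shows "qform (Re_op B) x = qform B x"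
  using Re_cinner_commute[of x "B x"] by (simp add: qform_def cinner_Re_op[OF assms])

lemma selfadjoint_Re_op:
  assumes B: "bounded_clinear B"
  shows "selfadjoint (Re_op B)"
proof -
  note f = cinner_Re_op[OF B]
  have add: "Re_op B (x + y) = Re_op B x + Re_op B y" for x y
    by (rule cinner_ext)
      (simp add: f cinner_add_right bounded_clinear_add[OF B] add_divide_distrib)
  have scale: "Re_op B (c *\<^sub>C x) = c *\<^sub>C Re_op B x" for c x
    by (rule cinner_ext)
      (simp add: f cinner_scaleC_right bounded_clinear_scaleC[OF B] algebra_simps)
  have sym: "cinner (Re_op B x) y = cinner x (Re_op B y)" for x y
    by (subst cinner_commute) (simp add: f cinner_commute[of "B y" x] cinner_commute[of y "B x"])
  have "norm (Re_op B x) \<le> onorm B * norm x" for x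
  proof -
    let ?y = "Re_op B x"
    have "(norm ?y)\<^sup>2 = Re (cinner ?y (B x) + cinner (B ?y) x) / 2"
      using arg_cong[OF f[of ?y x], of Re] by simp
    also have "\<dots> \<le> (norm ?y * norm (B x) + norm (B ?y) * norm x) / 2"
      using cauchy_schwarz[of ?y "B x"] cauchy_schwarz[of "B ?y" x]
        complex_Re_le_cmod[of "cinner ?y (B x)"] complex_Re_le_cmod[of "cinner (B ?y) x"] by simp
    also have "\<dots> \<le> (norm ?y * (onorm B * norm x) + (onorm B * norm ?y) * norm x) / 2"
      using bounded_clinear_bound[OF B]
      by (intro divide_right_mono add_mono mult_left_mono mult_right_mono) auto
    finally have "norm ?y * norm ?y \<le> norm ?y * (onorm B * norm x)"
      by (simp add: power2_eq_square mult_ac)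
    then show ?thesis
      by (cases "norm ?y = 0")
        (auto simp: B[unfolded bounded_clinear_def] onorm_pos_le)
  qed
  then have "bounded_clinear (Re_op B)" using add scale by (intro bounded_clinearI)
  then show ?thesis using sym by (simp add: selfadjoint_def)
qed

section \<open>Orthonormal families and their spans\<close>

definition orthonormal :: "nat \<Rightarrow> (nat \<Rightarrow> 'a::complex_hilbert_space) \<Rightarrow> bool" where
  "orthonormal n e \<longleftrightarrow> (\<forall>i<n. \<forall>j<n. cinner (e i) (e j) = (if i = j then 1 else 0))"

definition independent_family :: "nat \<Rightarrow> (nat \<Rightarrow> 'a::complex_hilbert_space) \<Rightarrow> bool" where
  "independent_family n e \<longleftrightarrow> (\<forall>c. (\<Sum>i<n. c i *\<^sub>C e i) = 0 \<longrightarrow> (\<forall>i<n. c i = 0))"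

abbreviation fspan :: "nat \<Rightarrow> (nat \<Rightarrow> 'a::complex_hilbert_space) \<Rightarrow> 'a set" where
  "fspan n e \<equiv> cspan (e ` {..<n})"

lemma mem_fspan_iff: "x \<in> fspan n e \<longleftrightarrow> (\<exists>c. x = (\<Sum>i<n. c i *\<^sub>C e i))"
proof
  let ?L = "range (\<lambda>c. \<Sum>i<n. c i *\<^sub>C e i)"
  have "complex_vector.subspace ?L"
  proof (rule complex_vector.subspaceI)
    show "0 \<in> ?L" by (rule range_eqI[of _ _ "\<lambda>_. 0"]) simp
  next
    fix x y assume "x \<in> ?L" "y \<in> ?L"
    then obtain c d where "x = (\<Sum>i<n. c i *\<^sub>C e i)" "y = (\<Sum>i<n. d i *\<^sub>C e i)" by auto
    then show "x + y \<in> ?L"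
      by (intro range_eqI[of _ _ "\<lambda>i. c i + d i"]) (simp add: scaleC_add_left sum.distrib)
  next
    fix a x assume "x \<in> ?L"
    then obtain c where "x = (\<Sum>i<n. c i *\<^sub>C e i)" by auto
    then show "a *\<^sub>C x \<in> ?L"
      by (intro range_eqI[of _ _ "\<lambda>i. a * c i"])
        (simp add: complex_vector.scale_sum_right scaleC_scaleC)
  qed
  moreover have "e ` {..<n} \<subseteq> ?L"
  proof safe
    fix j assume "j < n"
    then have "e j = (\<Sum>i<n. if i = j then e i else 0)" by simp
    also have "\<dots> = (\<Sum>i<n. (if i = j then 1 else 0) *\<^sub>C e i)"
      by (rule sum.cong) (simp_all add: scaleC_one)
    finally show "e j \<in> ?L" by (rule range_eqI[of _ _ "\<lambda>i. if i = j then 1 else 0"])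
  qed
  ultimately have "fspan n e \<subseteq> ?L" by (intro complex_vector.span_minimal)
  then show "x \<in> fspan n e \<Longrightarrow> \<exists>c. x = (\<Sum>i<n. c i *\<^sub>C e i)" by auto
next
  assume "\<exists>c. x = (\<Sum>i<n. c i *\<^sub>C e i)"
  then show "x \<in> fspan n e"
  proof (elim exE, simp only:)
    fix c
    show "(\<Sum>i<n. c i *\<^sub>C e i) \<in> fspan n e"
      by (rule complex_vector.span_sum, rule complex_vector.span_scale, rule complex_vector.span_base)
        simp
  qed
qed

lemma fspan_subset: "(\<And>i. i < m \<Longrightarrow> g i \<in> fspan n e) \<Longrightarrow> fspan m g \<subseteq> fspan n e"
  by (rule complex_vector.span_minimal) (auto simp: complex_vector.subspace_span)

lemma fspan_mem: "i < n \<Longrightarrow> e i \<in> fspan n e"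
  by (simp add: complex_vector.span_base)

lemma orthogonal_fspan:
  assumes "\<And>i. i < n \<Longrightarrow> cinner (e i) w = 0" "u \<in> fspan n e"
  shows "cinner u w = 0"
proof -
  obtain c where "u = (\<Sum>i<n. c i *\<^sub>C e i)" using assms(2) mem_fspan_iff by blast
  then show ?thesis using assms(1) by (simp add: cinner_sum_left cinner_scaleC_left)
qed

lemma orthonormal_coordinate:
  assumes "orthonormal n e" "j < n"
  shows "cinner (e j) (\<Sum>i<n. c i *\<^sub>C e i) = c j"
proof -
  have "cinner (e j) (\<Sum>i<n. c i *\<^sub>C e i) = (\<Sum>i<n. if j = i then c i else 0)"
    unfolding cinner_sum_right using assms
    by (intro sum.cong) (auto simp: orthonormal_def cinner_scaleC_right)
  then show ?thesis using assms(2) by simp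
qed

lemma orthonormal_norm:
  assumes "orthonormal n e" "i < n"
  shows "norm (e i) = 1"
proof -
  have "(norm (e i))\<^sup>2 = 1"
    using assms unfolding Re_cinner_self[symmetric] by (simp add: orthonormal_def del: Re_cinner_self)
  then show ?thesis by (simp add: power2_eq_1_iff) (smt (verit) norm_ge_zero)
qed

lemma orthonormal_independent: "orthonormal n e \<Longrightarrow> independent_family n e"
  unfolding independent_family_def
proof (intro allI impI)
  fix c i assume "orthonormal n e" "(\<Sum>i<n. c i *\<^sub>C e i) = 0" "i < n"
  then show "c i = 0" using orthonormal_coordinate[of n e i c] by simp
qed

lemma orthonormal_mono: "orthonormal n e \<Longrightarrow> m \<le> n \<Longrightarrow> orthonormal m e"
  by (simp add: orthonormal_def)

lemma orthonormal_snoc: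
  assumes "orthonormal n e" "\<And>i. i < n \<Longrightarrow> cinner (e i) x = 0" "norm x = 1"
  shows "orthonormal (Suc n) (e(n := x))"
  using assms cinner_eq_zero_sym[of _ x]
  by (auto simp: orthonormal_def less_Suc_eq cinner_self)

lemma mem_fspan_snoc:
  assumes "y \<in> fspan (Suc n) (e(n := x))"
  obtains u a where "u \<in> fspan n e" "y = u + a *\<^sub>C x"
proof -
  have "(e(n := x)) ` {..<Suc n} = insert x (e ` {..<n})"
    by (auto simp: lessThan_Suc)
  then obtain a where "y - a *\<^sub>C x \<in> fspan n e"
    using assms complex_vector.span_insert[of x "e ` {..<n}"] by auto
  then show ?thesis using that[of "y - a *\<^sub>C x" a] by simp
qed

lemma norm_normalized: "x \<noteq> 0 \<Longrightarrow> norm (complex_of_real (1 / norm x) *\<^sub>C x) = 1"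
  for x :: "'a::complex_hilbert_space"
  by (simp add: norm_scaleC norm_divide)

text \<open>Homogeneous systems with fewer equations than unknowns are solvable: padding the coefficient
  matrix with zero rows makes it a square matrix of determinant zero.\<close>

lemma exists_orthogonal_in_fspan:
  fixes e f :: "nat \<Rightarrow> 'a::complex_hilbert_space"
  assumes e: "independent_family n e" and r: "r < n"
  shows "\<exists>x \<in> fspan n e. x \<noteq> 0 \<and> (\<forall>i<r. cinner (f i) x = 0)"
proof -
  define M where "M = mat n n (\<lambda>(i, j). if i < r then cinner (f i) (e j) else 0)"
  have M: "M \<in> carrier_mat n n" by (simp add: M_def)
  let ?u = "unit_vec n (n - 1)"
  have "M\<^sup>T *\<^sub>v ?u = 0\<^sub>v n"
    using r by (intro eq_vecI) (auto simp: M_def)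
  moreover have "?u \<noteq> 0\<^sub>v n" using r by (auto simp: vec_eq_iff)
  ultimately have "det M\<^sup>T = 0"
    using det_0_iff_vec_prod_zero[of "M\<^sup>T" n] M unit_vec_carrier[of n "n - 1"]
    by (simp only: transpose_carrier_mat) blast
  then obtain v where v: "v \<in> carrier_vec n" "v \<noteq> 0\<^sub>v n" "M *\<^sub>v v = 0\<^sub>v n"
    using det_0_iff_vec_prod_zero[OF M] det_transpose[OF M] by auto
  define x where "x = (\<Sum>i<n. v $ i *\<^sub>C e i)"
  have "cinner (f i) x = 0" if "i < r" for i
  proof -
    have "0 = (M *\<^sub>v v) $ i" using v(3) that r by simp
    also have "\<dots> = (\<Sum>j<n. cinner (f i) (e j) * v $ j)"
      using that r v(1) by (simp add: M_def scalar_prod_def lessThan_atLeast0)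
    finally show ?thesis by (simp add: x_def cinner_sum_right cinner_scaleC_right mult.commute)
  qed
  moreover have "x \<noteq> 0"
  proof
    assume "x = 0"
    then have "\<forall>i<n. v $ i = 0" using e unfolding independent_family_def x_def by blast
    then show False using v(1,2) by (auto simp: vec_eq_iff)
  qed
  moreover have "x \<in> fspan n e" unfolding x_def mem_fspan_iff by (rule exI[of _ "\<lambda>i. v $ i"]) simp
  ultimately show ?thesis by blast
qed

text \<open>A subspace of dimension \<open>n\<close> meets the solution set of \<open>r\<close> linear equations in dimension at least
  \<open>n - r\<close>.  The orthonormal family grows by one vector at a time, its own members being imposed as
  further equations.  With \<open>r = 0\<close> this also replaces the Gram--Schmidt process.\<close>

lemma exists_orthonormal_orthogonal_in_fspan:
  fixes e f :: "nat \<Rightarrow> 'a::complex_hilbert_space"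
  assumes e: "independent_family n e" and "r + m \<le> n"
  shows "\<exists>g. orthonormal m g \<and> (\<forall>i<m. g i \<in> fspan n e) \<and> (\<forall>i<m. \<forall>j<r. cinner (f j) (g i) = 0)"
  using assms(2)
proof (induction m)
  case 0
  show ?case by (simp add: orthonormal_def)
next
  case (Suc m)
  then obtain g where g: "orthonormal m g" "\<forall>i<m. g i \<in> fspan n e"
    "\<forall>i<m. \<forall>j<r. cinner (f j) (g i) = 0" by auto
  obtain y where y: "y \<in> fspan n e" "y \<noteq> 0"
    "\<forall>i<r + m. cinner (if i < r then f i else g (i - r)) y = 0"
    using exists_orthogonal_in_fspan[OF e, of "r + m" "\<lambda>i. if i < r then f i else g (i - r)"] Suc.prems
    by auto
  define x where "x = complex_of_real (1 / norm y) *\<^sub>C y"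
  have x1: "norm x = 1" unfolding x_def by (rule norm_normalized[OF y(2)])
  have xe: "x \<in> fspan n e" unfolding x_def using y(1) by (rule complex_vector.span_scale)
  have gx: "cinner (g i) x = 0" if "i < m" for i
    using y(3)[rule_format, of "r + i"] that by (simp add: x_def cinner_scaleC_right)
  have fx: "cinner (f j) x = 0" if "j < r" for j
    using y(3)[rule_format, of j] that by (simp add: x_def cinner_scaleC_right)
  show ?case
  proof (intro exI[of _ "g(m := x)"] conjI)
    show "orthonormal (Suc m) (g(m := x))" using g(1) gx x1 by (rule orthonormal_snoc)
    show "\<forall>i<Suc m. (g(m := x)) i \<in> fspan n e" using g(2) xe by (simp add: less_Suc_eq)
    show "\<forall>i<Suc m. \<forall>j<r. cinner (f j) ((g(m := x)) i) = 0"
      using g(3) fx by (simp add: less_Suc_eq)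
  qed
qed

lemma independent_family_of_set:
  fixes S :: "'a::complex_hilbert_space set"
  assumes "finite S" "card S = n" "\<not> cdependent S"
  obtains e :: "nat \<Rightarrow> 'a::complex_hilbert_space" where "independent_family n e"
proof -
  obtain e where e: "bij_betw e {0..<n} S"
    using ex_bij_betw_nat_finite[OF assms(1)] assms(2) by auto
  have "independent_family n e"
    unfolding independent_family_def
  proof (intro allI impI)
    fix c i assume c: "(\<Sum>i<n. c i *\<^sub>C e i) = 0" and i: "i < n"
    define u where "u = (\<lambda>v. c (inv_into {0..<n} e v))"
    have u: "u (e j) = c j" if "j < n" for j
      using that bij_betw_inv_into_left[OF e, of j] by (simp add: u_def)
    have "(\<Sum>v\<in>S. u v *\<^sub>C v) = (\<Sum>i\<in>{0..<n}. u (e i) *\<^sub>C e i)"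
      by (rule sum.reindex_bij_betw[OF e, symmetric])
    also have "\<dots> = 0" using c by (simp add: u lessThan_atLeast0)
    finally have "\<forall>v\<in>S. u v = 0"
      using assms(1,3) complex_vector.dependent_finite[OF assms(1)] by blast
    then show "c i = 0" using u[OF i] bij_betwE[OF e] i by force
  qed
  then show ?thesis by (rule that)
qed

lemma cdim_ge_orthonormal:
  assumes "cdim_ge TYPE('a::complex_hilbert_space) n"
  obtains e :: "nat \<Rightarrow> 'a::complex_hilbert_space" where "orthonormal n e"
proof -
  obtain S :: "'a set" where "finite S" "card S = n" "\<not> cdependent S"
    using assms by (auto simp: cdim_ge_def)
  then obtain e :: "nat \<Rightarrow> 'a" where "independent_family n e" by (rule independent_family_of_set)
  then show ?thesis
    using exists_orthonormal_orthogonal_in_fspan[of n e 0 n] that by auto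
qed

lemma orthonormal_inj: "orthonormal n e \<Longrightarrow> inj_on e {..<n}"
  by (rule inj_onI) (metis lessThan_iff orthonormal_def zero_neq_one)

section \<open>Orthogonal projections onto the span of an orthonormal family\<close>

definition fproj :: "nat \<Rightarrow> (nat \<Rightarrow> 'a::complex_hilbert_space) \<Rightarrow> 'a \<Rightarrow> 'a" where
  "fproj n e x = (\<Sum>i<n. cinner (e i) x *\<^sub>C e i)"

lemma fproj_mem: "fproj n e x \<in> fspan n e"
  unfolding mem_fspan_iff fproj_def by (rule exI[of _ "\<lambda>i. cinner (e i) x"]) simp

lemma fproj_residual:
  "orthonormal n e \<Longrightarrow> i < n \<Longrightarrow> cinner (e i) (x - fproj n e x) = 0"
  using orthonormal_coordinate[of n e i "\<lambda>i. cinner (e i) x"]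
  by (simp add: cinner_diff_right fproj_def)

lemma fproj_id: "orthonormal n e \<Longrightarrow> x \<in> fspan n e \<Longrightarrow> fproj n e x = x"
  by (auto simp: mem_fspan_iff fproj_def orthonormal_coordinate intro!: sum.cong)

lemma fproj_sym: "cinner (fproj n e x) y = cinner x (fproj n e y)"
  unfolding fproj_def cinner_sum_left cinner_sum_right
  by (rule sum.cong)
    (simp_all add: cinner_scaleC_left cinner_scaleC_right cinner_commute[of x] mult.commute)

lemma qform_fproj: "orthonormal n e \<Longrightarrow> qform (fproj n e) x = (norm (fproj n e x))\<^sup>2"
  unfolding qform_def Re_cinner_self[symmetric]
  by (simp add: fproj_sym fproj_id fproj_mem del: Re_cinner_self)

lemma fproj_bounded_clinear: "bounded_clinear (fproj n e)"
proof (rule bounded_clinearI[where C = "\<Sum>i<n. norm (e i) * norm (e i)"])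
  fix x
  have "norm (fproj n e x) \<le> (\<Sum>i<n. norm (cinner (e i) x *\<^sub>C e i))"
    unfolding fproj_def by (rule norm_sum)
  also have "\<dots> \<le> (\<Sum>i<n. norm (e i) * norm (e i) * norm x)"
  proof (rule sum_mono)
    fix i
    show "norm (cinner (e i) x *\<^sub>C e i) \<le> norm (e i) * norm (e i) * norm x"
      using mult_left_mono[OF cauchy_schwarz[of "e i" x] norm_ge_zero[of "e i"]]
      by (simp add: norm_scaleC mult_ac)
  qed
  finally show "norm (fproj n e x) \<le> (\<Sum>i<n. norm (e i) * norm (e i)) * norm x"
    by (simp add: sum_distrib_right)
qed (simp_all add: fproj_def cinner_add_right cinner_scaleC_right scaleC_add_left sum.distrib
    complex_vector.scale_sum_right scaleC_scaleC)

lemma fproj_in_projections: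
  assumes e: "orthonormal n e"
  shows "fproj n e \<in> projections n"
proof -
  have idem: "fproj n e \<circ> fproj n e = fproj n e"
    by (rule ext) (simp add: fproj_id[OF e fproj_mem])
  have adj: "cadjoint (fproj n e) = fproj n e"
    by (rule cadjoint_eqI) (rule fproj_sym)
  have "\<not> cdependent (e ` {..<n})"
  proof
    assume "cdependent (e ` {..<n})"
    then obtain u v where u: "(\<Sum>v\<in>e ` {..<n}. u v *\<^sub>C v) = 0" "v \<in> e ` {..<n}" "u v \<noteq> 0"
      using complex_vector.dependent_finite[of "e ` {..<n}"] by auto
    then have "(\<Sum>i<n. u (e i) *\<^sub>C e i) = 0"
      by (simp add: sum.reindex[OF orthonormal_inj[OF e]])
    then show False
      using u orthonormal_independent[OF e] unfolding independent_family_def by fastforce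
  qed
  moreover have "fspan n e = range (fproj n e)"
  proof (intro equalityI subsetI)
    fix x assume "x \<in> fspan n e"
    then show "x \<in> range (fproj n e)" using fproj_id[OF e, of x] by (intro range_eqI[of _ _ x]) simp
  qed (auto simp: fproj_mem)
  ultimately have "has_rank (fproj n e) n"
    unfolding has_rank_def
    by (intro exI[of _ "e ` {..<n}"]) (simp add: card_image[OF orthonormal_inj[OF e]])
  then show ?thesis using idem adj by (simp add: projections_def fproj_bounded_clinear)
qed

text \<open>A projection of rank \<open>r\<close> imposes only \<open>r\<close> linear equations on its kernel: by self-adjointness the
  kernel is the orthogonal complement of the range, which \<open>r\<close> vectors span.\<close>

lemma projection_kernel_equations:
  assumes "P \<in> projections r"
  obtains f where "\<And>x. (\<And>i. i < r \<Longrightarrow> cinner (f i) x = 0) \<Longrightarrow> P x = 0"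
proof -
  have P: "bounded_clinear P" "cadjoint P = P" "has_rank P r"
    using assms by (auto simp: projections_def)
  obtain S where S: "finite S" "card S = r" "cspan S = range P"
    using P(3) by (auto simp: has_rank_def)
  obtain f where f: "bij_betw f {0..<r} S"
    using ex_bij_betw_nat_finite[OF S(1)] S(2) by auto
  have range: "fspan r f = range P"
    using f S(3) by (simp add: bij_betw_def lessThan_atLeast0)
  show ?thesis
  proof (rule that[of f])
    fix x assume "\<And>i. i < r \<Longrightarrow> cinner (f i) x = 0"
    then have "cinner (P (P x)) x = 0"
      using orthogonal_fspan[of r f x] range by blast
    then have "cinner (P x) (P x) = 0"
      using cinner_cadjoint[OF P(1)] P(2) by simp
    then show "P x = 0" by (simp add: cinner_self)
  qed
qed

section \<open>The Courant--Fischer description of the numbers \<open>lambda_op m H\<close>\<close>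

text \<open>The vectors of the span whose coordinates have real and imaginary parts in \<open>[-1, 1]\<close> form a
  continuous image of a cube, and the unit sphere is a closed subset of them.\<close>

lemma compact_unit_sphere_fspan:
  fixes e :: "nat \<Rightarrow> 'a::complex_hilbert_space"
  assumes e: "orthonormal n e"
  shows "compact {x \<in> fspan n e. norm x = 1}"
proof -
  define D :: "complex set" where "D = {z. Re z \<in> {-1..1} \<and> Im z \<in> {-1..1}}"
  define K where "K = (\<lambda>m. {\<Sum>i<m. c i *\<^sub>C e i | c. \<forall>i<m. c i \<in> D})"
  have "compact (K m)" for m
  proof (induction m)
    case 0
    show ?case by (simp add: K_def)
  next
    case (Suc m)
    let ?g = "\<lambda>(x, a, b). x + (a *\<^sub>R e m + b *\<^sub>R (\<i> *\<^sub>C e m))"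
    have "compact (?g ` (K m \<times> {-1..1} \<times> {-1..1}))"
      by (intro compact_continuous_image compact_Times Suc compact_Icc)
        (auto simp: case_prod_unfold intro!: continuous_intros)
    moreover have g: "?g (x, Re z, Im z) = x + z *\<^sub>C e m" for x z
    proof -
      have "z *\<^sub>C e m = (complex_of_real (Re z) + complex_of_real (Im z) * \<i>) *\<^sub>C e m"
        by (simp add: complex_eq mult.commute)
      then show ?thesis by (simp add: scaleC_scaleR scaleC_add_left scaleC_scaleC)
    qed
    have "K (Suc m) = ?g ` (K m \<times> {-1..1} \<times> {-1..1})"
    proof (intro equalityI subsetI)
      fix x assume "x \<in> K (Suc m)"
      then obtain c where c: "x = (\<Sum>i<m. c i *\<^sub>C e i) + c m *\<^sub>C e m" "\<forall>i<Suc m. c i \<in> D"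
        by (auto simp: K_def)
      then have "(\<Sum>i<m. c i *\<^sub>C e i) \<in> K m" "c m \<in> D" by (auto simp: K_def)
      then show "x \<in> ?g ` (K m \<times> {-1..1} \<times> {-1..1})"
        unfolding c(1) g[symmetric] by (intro imageI) (auto simp: D_def)
    next
      fix x assume "x \<in> ?g ` (K m \<times> {-1..1} \<times> {-1..1})"
      then obtain y a b where y: "y \<in> K m" "a \<in> {-1..1}" "b \<in> {-1..1}" "x = ?g (y, a, b)"
        by auto
      obtain c where c: "y = (\<Sum>i<m. c i *\<^sub>C e i)" "\<forall>i<m. c i \<in> D"
        using y(1) by (auto simp: K_def)
      let ?c = "c(m := Complex a b)"
      have "x = (\<Sum>i<Suc m. ?c i *\<^sub>C e i)" using g[of y "Complex a b"] y(4) c(1) by simp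
      moreover have "\<forall>i<Suc m. ?c i \<in> D" using c(2) y(2,3) by (simp add: less_Suc_eq D_def)
      ultimately show "x \<in> K (Suc m)" unfolding K_def by blast
    qed
    ultimately show ?case by simp
  qed
  moreover have "{x \<in> fspan n e. norm x = 1} = K n \<inter> {x. norm x = 1}"
  proof (intro equalityI subsetI)
    fix x assume x: "x \<in> {x \<in> fspan n e. norm x = 1}"
    then obtain c where c: "x = (\<Sum>i<n. c i *\<^sub>C e i)" by (auto simp: mem_fspan_iff)
    have "c i \<in> D" if "i < n" for i
    proof -
      have "cmod (c i) \<le> 1"
        using orthonormal_coordinate[OF e that, of c] cauchy_schwarz[of "e i" x]
          orthonormal_norm[OF e that] x c by simp
      then show ?thesis
        using abs_Re_le_cmod[of "c i"] abs_Im_le_cmod[of "c i"] by (simp add: D_def abs_le_iff)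
    qed
    then show "x \<in> K n \<inter> {x. norm x = 1}" using x c unfolding K_def by blast
  qed (auto simp: K_def mem_fspan_iff)
  moreover have "closed {x :: 'a. norm x = 1}"
    by (intro closed_Collect_eq continuous_intros)
  ultimately show ?thesis by (simp add: compact_Int_closed)
qed

text \<open>The last conclusion is the Euler--Lagrange equation of the minimization: the compression of \<open>H\<close> to
  the subspace has the minimizer \<open>x\<close> as an eigenvector.  It holds because \<open>H - qform H x\<close> is
  non-negative on the subspace and its form vanishes at \<open>x\<close>.\<close>

lemma rayleigh_minimizer:
  assumes e: "orthonormal n e" and n: "n \<ge> 1" and H: "selfadjoint H"
  obtains x where "x \<in> fspan n e" "norm x = 1"
    "\<And>y. y \<in> fspan n e \<Longrightarrow> qform H x * (norm y)\<^sup>2 \<le> qform H y"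
    "\<And>y. y \<in> fspan n e \<Longrightarrow> cinner y (H x) = complex_of_real (qform H x) * cinner y x"
proof -
  let ?S = "{x \<in> fspan n e. norm x = 1}"
  have Hb: "bounded_clinear H" using H by (rule selfadjoint_bounded_clinear)
  have "bounded_linear H" using Hb by (simp add: bounded_clinear_def)
  have cont: "continuous_on ?S (qform H)"
  proof -
    have *: "qform H x = ((norm (x + H x))\<^sup>2 - (norm x)\<^sup>2 - (norm (H x))\<^sup>2) / 2" for x
      using norm_add_square[of x "H x"] by (simp add: qform_def)
    show ?thesis unfolding *
      by (intro continuous_intros bounded_linear.continuous_on[OF \<open>bounded_linear H\<close>]) simp
  qed
  have "e 0 \<in> ?S" using n fspan_mem[of 0 n e] orthonormal_norm[OF e, of 0] by simp
  then obtain x where x: "x \<in> ?S" "\<forall>y\<in>?S. qform H x \<le> qform H y"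
    using continuous_attains_inf[OF compact_unit_sphere_fspan[OF e] _ cont] by blast
  define s where "s = qform H x"
  have min: "s * (norm y)\<^sup>2 \<le> qform H y" if y: "y \<in> fspan n e" for y
  proof (cases "y = 0")
    case True
    then show ?thesis by (simp add: qform_def)
  next
    case False
    define z where "z = complex_of_real (1 / norm y) *\<^sub>C y"
    have "z \<in> ?S"
      unfolding z_def using norm_normalized[OF False] complex_vector.span_scale[OF y] by blast
    then have "s \<le> qform H z" using x(2) by (simp add: s_def)
    also have "qform H z = qform H y / (norm y)\<^sup>2"
      unfolding z_def qform_scaleC[OF Hb] by (simp add: power_divide norm_divide)
    finally show ?thesis using False by (simp add: field_simps)
  qed
  let ?G = "\<lambda>x. (- s) *\<^sub>R x + 1 *\<^sub>R H x"
  have psd: "0 \<le> qform ?G y" if "y \<in> fspan n e" for y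
    unfolding qform_shift using min[OF that] by simp
  have "cinner y (H x) = complex_of_real s * cinner y x" if y: "y \<in> fspan n e" for y
  proof -
    have "(cmod (cinner y (?G x)))\<^sup>2 \<le> qform ?G x * qform ?G y"
      by (rule psd_cauchy_schwarz[OF selfadjoint_shift[OF H]])
        (use x y in \<open>blast intro: psd complex_vector.span_add complex_vector.span_scale\<close>)+
    moreover have "qform ?G x = 0" unfolding qform_shift using x by (simp add: s_def)
    ultimately have "cinner y (?G x) = 0" by simp
    then show ?thesis by (simp add: cinner_add_right cinner_diff_right)
  qed
  then show ?thesis using x min that[of x] by (simp add: s_def)
qed

text \<open>The matrix of \<open>X\<^sup>* H X\<close> for the isometry \<open>X\<close> that sends the standard basis to \<open>e\<close>.\<close>

definition compression :: "nat \<Rightarrow> (nat \<Rightarrow> 'a::complex_hilbert_space) \<Rightarrow> ('a \<Rightarrow> 'a) \<Rightarrow> complex mat" where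
  "compression m e H = mat m m (\<lambda>(i, j). cinner (e i) (H (e j)))"

lemma compression_carrier [simp]: "compression m e H \<in> carrier_mat m m"
  by (simp add: compression_def)

lemma compression_mult_vec:
  assumes "bounded_clinear H" "v \<in> carrier_vec m" "i < m"
  shows "(compression m e H *\<^sub>v v) $ i = cinner (e i) (H (\<Sum>j<m. v $ j *\<^sub>C e j))"
  using assms(2,3)
  by (simp add: compression_def scalar_prod_def bounded_clinear_sum[OF assms(1)]
      bounded_clinear_scaleC[OF assms(1)] cinner_sum_right cinner_scaleC_right
      lessThan_atLeast0 mult.commute)

lemma compression_eigenvalue_qform:
  assumes H: "bounded_clinear H" and e: "orthonormal m e" and z: "eigenvalue (compression m e H) z"
  shows "\<exists>x \<in> fspan m e. x \<noteq> 0 \<and> qform H x = Re z * (norm x)\<^sup>2"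
proof -
  obtain v where v: "v \<in> carrier_vec m" "v \<noteq> 0\<^sub>v m" "compression m e H *\<^sub>v v = z \<cdot>\<^sub>v v"
    using z by (auto simp: eigenvalue_def eigenvector_def compression_def)
  define x where "x = (\<Sum>j<m. v $ j *\<^sub>C e j)"
  have coord: "cinner (e i) x = v $ i" if "i < m" for i
    unfolding x_def by (rule orthonormal_coordinate[OF e that])
  have "cinner (e i) (H x - z *\<^sub>C x) = 0" if "i < m" for i
    using compression_mult_vec[OF H v(1) that, of e] v(1,3) that coord[OF that]
    by (simp add: x_def[symmetric] cinner_diff_right cinner_scaleC_right)
  moreover have x: "x \<in> fspan m e"
    unfolding x_def mem_fspan_iff by (rule exI[of _ "\<lambda>i. v $ i"]) simp
  ultimately have "cinner x (H x - z *\<^sub>C x) = 0" by (rule orthogonal_fspan)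
  then have "qform H x = Re (z * cinner x x)"
    by (simp add: qform_def cinner_diff_right cinner_scaleC_right)
  then have "qform H x = Re z * (norm x)\<^sup>2" by (simp add: cinner_self del: of_real_power)
  moreover have "x \<noteq> 0"
  proof
    assume "x = 0"
    then have "\<forall>i<m. v $ i = 0" using coord by simp
    then show False using v(1,2) by (auto simp: vec_eq_iff)
  qed
  ultimately show ?thesis using x by blast
qed

lemma compression_eigenvalueI:
  assumes H: "bounded_clinear H" and x: "x \<in> fspan m e" "x \<noteq> 0" and e: "orthonormal m e"
    and eig: "\<And>y. y \<in> fspan m e \<Longrightarrow> cinner y (H x) = s * cinner y x"
  shows "eigenvalue (compression m e H) s"
proof -
  obtain c where c: "x = (\<Sum>i<m. c i *\<^sub>C e i)" using x(1) by (auto simp: mem_fspan_iff)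
  define v where "v = vec m c"
  have xv: "x = (\<Sum>i<m. v $ i *\<^sub>C e i)" unfolding c by (rule sum.cong) (simp_all add: v_def)
  have v: "v \<in> carrier_vec m" by (simp add: v_def)
  have "v \<noteq> 0\<^sub>v m" using x(2) unfolding xv by auto
  moreover have "compression m e H *\<^sub>v v = s \<cdot>\<^sub>v v"
  proof (rule eq_vecI)
    fix i assume "i < dim_vec (s \<cdot>\<^sub>v v)"
    then have i: "i < m" by (simp add: v_def)
    have "(compression m e H *\<^sub>v v) $ i = cinner (e i) (H x)"
      unfolding xv by (rule compression_mult_vec[OF H v i])
    also have "\<dots> = s * cinner (e i) x" by (rule eig[OF fspan_mem[OF i]])
    also have "cinner (e i) x = v $ i" unfolding xv by (rule orthonormal_coordinate[OF e i])
    finally show "(compression m e H *\<^sub>v v) $ i = (s \<cdot>\<^sub>v v) $ i" using i by (simp add: v_def)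
  qed (simp add: compression_def v_def)
  ultimately show ?thesis using v
    unfolding eigenvalue_def eigenvector_def by (auto simp: compression_def)
qed

text \<open>In a decreasing list of all \<open>m\<close> roots of the characteristic polynomial, the entry with number
  \<open>m\<close> is the smallest one.\<close>

lemma eigval_desc_last:
  assumes M: "M \<in> carrier_mat m m" and m: "m \<ge> 1"
  shows "\<exists>z. eigenvalue M z \<and> eigval_desc M m = Re z"
    and "eigenvalue M z \<Longrightarrow> eigval_desc M m \<le> Re z"
proof -
  let ?p = "char_poly M"
  let ?L = "sorted_list_of_multiset (image_mset Re (proots ?p))"
  have deg: "degree ?p = m" "coeff ?p m = 1" using degree_monic_char_poly[OF M] by auto
  then have p0: "?p \<noteq> 0" by auto
  have len: "length ?L = m"
    by (metis deg(1) size_image_mset size_mset mset_sorted_list_of_multiset size_proots_complex)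
  have desc: "eigval_desc M m = ?L ! 0"
    unfolding eigval_desc_def using len m by (subst rev_nth) simp_all
  have set: "set ?L = Re ` {z. eigenvalue M z}"
    using p0 by (simp add: eigenvalue_root_char_poly[OF M])
  have "?L ! 0 \<in> set ?L" using len m by (intro nth_mem) simp
  then show "\<exists>z. eigenvalue M z \<and> eigval_desc M m = Re z" unfolding desc set by auto
  assume "eigenvalue M z"
  then have "Re z \<in> set ?L" unfolding set by blast
  then obtain j where "j < length ?L" "?L ! j = Re z" by (metis in_set_conv_nth)
  then show "eigval_desc M m \<le> Re z"
    unfolding desc using sorted_nth_mono[of ?L 0 j] by simp
qed

text \<open>The smallest eigenvalue of the compression is the minimum of the form on the unit sphere of the
  span.  The minimum is an eigenvalue by \<open>rayleigh_minimizer\<close>, so it is not below the smallest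
  one; and every eigenvalue is a value of the form at a normalized eigenvector.\<close>

lemma eigval_desc_compression:
  assumes H: "selfadjoint H" and e: "orthonormal m e" and m: "m \<ge> 1"
  defines "r \<equiv> eigval_desc (compression m e H) m"
  shows "\<And>x. x \<in> fspan m e \<Longrightarrow> r * (norm x)\<^sup>2 \<le> qform H x"
    and "\<exists>x \<in> fspan m e. x \<noteq> 0 \<and> qform H x = r * (norm x)\<^sup>2"
proof -
  have Hb: "bounded_clinear H" using H by (rule selfadjoint_bounded_clinear)
  obtain x where x: "x \<in> fspan m e" "norm x = 1"
    "\<And>y. y \<in> fspan m e \<Longrightarrow> qform H x * (norm y)\<^sup>2 \<le> qform H y"
    "\<And>y. y \<in> fspan m e \<Longrightarrow> cinner y (H x) = complex_of_real (qform H x) * cinner y x"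
    using rayleigh_minimizer[OF e m H] by blast
  have "eigenvalue (compression m e H) (complex_of_real (qform H x))"
    using x(2) by (intro compression_eigenvalueI[OF Hb x(1) _ e x(4)]) auto
  then have "r \<le> qform H x"
    using eigval_desc_last(2)[OF compression_carrier m] unfolding r_def by fastforce
  then show "r * (norm y)\<^sup>2 \<le> qform H y" if "y \<in> fspan m e" for y
    using x(3)[OF that] mult_right_mono[of r "qform H x" "(norm y)\<^sup>2"] by simp
  show "\<exists>x \<in> fspan m e. x \<noteq> 0 \<and> qform H x = r * (norm x)\<^sup>2"
    using eigval_desc_last(1)[OF compression_carrier m] compression_eigenvalue_qform[OF Hb e]
    unfolding r_def by metis
qed

text \<open>Isometries from \<open>\<complex>\<^sup>m\<close> are the same as orthonormal families of length \<open>m\<close>.\<close>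

lemma lambda_op_eq_Sup:
  "lambda_op m H = Sup {eigval_desc (compression m e H) m | e. orthonormal m e}"
proof -
  have comp: "matrix_of m (adjoint_from m X \<circ> H \<circ> X) = compression m (\<lambda>i. X (unit_vec m i)) H"
    for X and H :: "'a \<Rightarrow> 'a"
    by (auto simp: matrix_of_def adjoint_from_def compression_def)
  have isom: "matrix_of m (adjoint_from m X \<circ> X) = 1\<^sub>m m \<longleftrightarrow> orthonormal m (\<lambda>i. X (unit_vec m i))"
    for X :: "complex vec \<Rightarrow> 'a"
    unfolding orthonormal_def mat_eq_iff by (auto simp: matrix_of_def adjoint_from_def)
  have ex: "\<exists>X. clinear_from m X \<and> (\<forall>i<m. X (unit_vec m i) = e i)" for e :: "nat \<Rightarrow> 'a"
  proof (intro exI conjI allI impI)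
    let ?X = "\<lambda>v. \<Sum>j<m. v $ j *\<^sub>C e j"
    show "clinear_from m ?X"
      by (auto simp: clinear_from_def scaleC_add_left sum.distrib scaleC_scaleC
          complex_vector.scale_sum_right)
    fix i assume i: "i < m"
    have "?X (unit_vec m i) = (\<Sum>j<m. if j = i then e j else 0)"
      using i by (intro sum.cong) (auto simp: scaleC_one)
    then show "?X (unit_vec m i) = e i" using i by simp
  qed
  have "{eigval_desc (matrix_of m (adjoint_from m X \<circ> H \<circ> X)) m | X.
            clinear_from m X \<and> matrix_of m (adjoint_from m X \<circ> X) = 1\<^sub>m m}
      = {eigval_desc (compression m e H) m | e. orthonormal m e}" (is "?L = ?R")
  proof (intro equalityI subsetI)
    fix z assume "z \<in> ?R"
    then obtain e where e: "z = eigval_desc (compression m e H) m" "orthonormal m e" by auto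
    obtain X where X: "clinear_from m X" "\<forall>i<m. X (unit_vec m i) = e i" using ex by blast
    have "orthonormal m (\<lambda>i. X (unit_vec m i))"
      using e(2) X(2) by (simp add: orthonormal_def)
    moreover have "compression m (\<lambda>i. X (unit_vec m i)) H = compression m e H"
      using X(2) by (auto simp: compression_def)
    ultimately show "z \<in> ?L" using e(1) X(1) unfolding comp isom
      by (intro CollectI exI[of _ X]) simp
  qed (unfold comp isom, auto)
  then show ?thesis by (simp add: lambda_op_def)
qed

lemma lambda_op_ge:
  assumes H: "selfadjoint H" and m: "m \<ge> 1" and e: "orthonormal m e"
    and c: "\<And>x. x \<in> fspan m e \<Longrightarrow> c * (norm x)\<^sup>2 \<le> qform H x"
  shows "c \<le> lambda_op m H"
proof -
  let ?A = "{eigval_desc (compression m e H) m | e. orthonormal m e}"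
  have Hb: "bounded_clinear H" using H by (rule selfadjoint_bounded_clinear)
  have "bdd_above ?A"
  proof (rule bdd_aboveI[of _ "onorm H"])
    fix r assume "r \<in> ?A"
    then obtain e where e: "r = eigval_desc (compression m e H) m" "orthonormal m e" by auto
    then obtain x where "x \<noteq> 0" "qform H x = r * (norm x)\<^sup>2"
      using eigval_desc_compression(2)[OF H e(2) m] by auto
    then show "r \<le> onorm H" using abs_qform_le[OF Hb, of x] by (simp add: abs_le_iff)
  qed
  moreover obtain x where x: "x \<in> fspan m e" "x \<noteq> 0"
    "qform H x = eigval_desc (compression m e H) m * (norm x)\<^sup>2"
    using eigval_desc_compression(2)[OF H e m] by auto
  have "c \<le> eigval_desc (compression m e H) m" using c[OF x(1)] x(2,3) by simp
  ultimately show ?thesis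
    unfolding lambda_op_eq_Sup using e by (auto intro!: cSup_upper2)
qed

lemma lambda_op_le:
  assumes H: "selfadjoint H" and m: "m \<ge> 1" and ex: "orthonormal m (e0 :: nat \<Rightarrow> 'a::complex_hilbert_space)"
    and c: "\<And>e r. orthonormal m e \<Longrightarrow> (\<And>x. x \<in> fspan m e \<Longrightarrow> r * (norm x)\<^sup>2 \<le> qform H x) \<Longrightarrow> r \<le> c"
  shows "lambda_op m (H :: 'a \<Rightarrow> 'a) \<le> c"
  unfolding lambda_op_eq_Sup
proof (rule cSup_least)
  fix r assume "r \<in> {eigval_desc (compression m e H) m | e. orthonormal m e}"
  then obtain e where "r = eigval_desc (compression m e H) m" "orthonormal m e" by auto
  then show "r \<le> c" using eigval_desc_compression(1)[OF H _ m] c by blast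
qed (use ex in blast)

text \<open>The dimension count behind Weyl's inequalities: on every subspace of dimension \<open>r + m\<close> the
  equations \<open>\<langle>f\<^sub>i, x\<rangle> = 0\<close> leave a subspace of dimension \<open>m\<close>, on which the form of \<open>H'\<close>
  dominates that of \<open>H\<close>.\<close>

lemma lambda_op_le_lambda_op_drop:
  fixes e0 f :: "nat \<Rightarrow> 'a::complex_hilbert_space"
  assumes H: "selfadjoint H" and H': "selfadjoint H'" and m: "m \<ge> 1"
    and ex: "orthonormal (r + m) e0"
    and le: "\<And>x. (\<And>i. i < r \<Longrightarrow> cinner (f i) x = 0) \<Longrightarrow> qform H x \<le> qform H' x"
  shows "lambda_op (r + m) H \<le> lambda_op m H'"
proof (rule lambda_op_le[OF H _ ex])
  fix e c assume e: "orthonormal (r + m) e"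
    and c: "\<And>x. x \<in> fspan (r + m) e \<Longrightarrow> c * (norm x)\<^sup>2 \<le> qform H x"
  obtain g where g: "orthonormal m g" "\<forall>i<m. g i \<in> fspan (r + m) e"
    "\<forall>i<m. \<forall>j<r. cinner (f j) (g i) = 0"
    using exists_orthonormal_orthogonal_in_fspan[OF orthonormal_independent[OF e] order_refl, of f]
    by blast
  show "c \<le> lambda_op m H'"
  proof (rule lambda_op_ge[OF H' m g(1)])
    fix x assume x: "x \<in> fspan m g"
    have "cinner x (f j) = 0" if "j < r" for j
      using g(3) that x cinner_eq_zero_sym by (blast intro: orthogonal_fspan)
    then have "qform H x \<le> qform H' x" using le cinner_eq_zero_sym by blast
    moreover have "x \<in> fspan (r + m) e" using fspan_subset[of m g] g(2) x by blast
    ultimately show "c * (norm x)\<^sup>2 \<le> qform H' x" using c[of x] by simp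
  qed
qed (use m in simp)

section \<open>Almost maximal orthonormal families\<close>

definition fperp :: "nat \<Rightarrow> (nat \<Rightarrow> 'a::complex_hilbert_space) \<Rightarrow> 'a set" where
  "fperp n e = {w. \<forall>i<n. cinner (e i) w = 0}"

lemma fperp_add_scaleC: "x \<in> fperp n e \<Longrightarrow> y \<in> fperp n e \<Longrightarrow> x + c *\<^sub>C y \<in> fperp n e"
  by (simp add: fperp_def cinner_add_right cinner_scaleC_right)

lemma fperp_scaleC: "x \<in> fperp n e \<Longrightarrow> c *\<^sub>C x \<in> fperp n e"
  by (simp add: fperp_def cinner_scaleC_right)

lemma fspan_fperp_orthogonal: "u \<in> fspan n e \<Longrightarrow> w \<in> fperp n e \<Longrightarrow> cinner u w = 0"
  by (rule orthogonal_fspan) (simp_all add: fperp_def)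

lemma pythagoras: "cinner x y = 0 \<Longrightarrow> (norm (x + y))\<^sup>2 = (norm x)\<^sup>2 + (norm y)\<^sup>2"
  for x :: "'a::complex_hilbert_space"
  by (simp add: norm_add_square)

text \<open>The number \<open>s\<close> is the supremum of the form over the unit sphere of \<open>fperp r v\<close>.  An orthonormal
  family longer than \<open>r\<close> makes this sphere non-empty.\<close>

lemma qform_sup_on_fperp:
  fixes v e0 :: "nat \<Rightarrow> 'a::complex_hilbert_space"
  assumes H: "bounded_clinear H" and ex: "orthonormal (Suc r) e0"
  obtains s where "\<And>w. w \<in> fperp r v \<Longrightarrow> qform H w \<le> s * (norm w)\<^sup>2"
    "\<And>\<delta>. \<delta> > 0 \<Longrightarrow> \<exists>w \<in> fperp r v. norm w = 1 \<and> s - \<delta> < qform H w"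
proof -
  let ?S = "{w \<in> fperp r v. norm w = 1}"
  define s where "s = (SUP w\<in>?S. qform H w)"
  have bdd: "bdd_above (qform H ` ?S)"
  proof (rule bdd_aboveI2)
    fix w assume "w \<in> ?S"
    then show "qform H w \<le> onorm H" using abs_qform_le[OF H, of w] by simp
  qed
  have unit: "complex_of_real (1 / norm x) *\<^sub>C x \<in> ?S" if "x \<in> fperp r v" "x \<noteq> 0" for x
    using that norm_normalized fperp_scaleC by blast
  obtain x where "x \<noteq> 0" "x \<in> fperp r v"
    using exists_orthogonal_in_fspan[OF orthonormal_independent[OF ex], of r v]
    by (auto simp: fperp_def)
  then have ne: "?S \<noteq> {}" using unit by blast
  show ?thesis
  proof (rule that[of s])
    fix w assume w: "w \<in> fperp r v"
    show "qform H w \<le> s * (norm w)\<^sup>2"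
    proof (cases "w = 0")
      case True
      then show ?thesis by (simp add: qform_def)
    next
      case False
      then have "qform H (complex_of_real (1 / norm w) *\<^sub>C w) \<le> s"
        unfolding s_def using unit[OF w] by (intro cSUP_upper bdd) blast
      moreover have "qform H (complex_of_real (1 / norm w) *\<^sub>C w) = qform H w / (norm w)\<^sup>2"
        unfolding qform_scaleC[OF H] by (simp add: power_divide norm_divide)
      ultimately have "qform H w / (norm w)\<^sup>2 \<le> s" by (simp only:)
      then show ?thesis using False by (simp add: field_simps)
    qed
  next
    fix \<delta> :: real assume "\<delta> > 0"
    then show "\<exists>w \<in> fperp r v. norm w = 1 \<and> s - \<delta> < qform H w"
      using less_cSUP_iff[OF ne bdd, of "s - \<delta>"] by (auto simp: s_def)
  qed
qed

text \<open>If two orthogonal directions almost decouple under \<open>H\<close>, a lower bound on each of them persists on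
  their sum; the cross term costs one further \<open>\<epsilon>\<close> by \<open>2 a b \<le> a\<^sup>2 + b\<^sup>2\<close>.\<close>

lemma qform_ge_on_orthogonal_sum:
  assumes H: "selfadjoint H" and x: "norm x = 1" and ux: "cinner u x = 0"
    and cross: "cmod (cinner x (H u)) \<le> \<epsilon> * norm u" and \<epsilon>: "0 \<le> \<epsilon>"
    and u: "(s - \<epsilon>) * (norm u)\<^sup>2 \<le> qform H u" and qx: "s - \<epsilon> \<le> qform H x"
  shows "(s - 2 * \<epsilon>) * (norm (u + a *\<^sub>C x))\<^sup>2 \<le> qform H (u + a *\<^sub>C x)"
proof -
  have Hb: "bounded_clinear H" using H by (rule selfadjoint_bounded_clinear)
  have norm: "(norm (u + a *\<^sub>C x))\<^sup>2 = (norm u)\<^sup>2 + (cmod a)\<^sup>2"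
    using pythagoras[of u "a *\<^sub>C x"] ux x by (simp add: cinner_scaleC_right norm_scaleC)
  have "cmod (cinner u (H (a *\<^sub>C x))) = cmod a * cmod (cinner x (H u))"
    by (simp add: bounded_clinear_scaleC[OF Hb] cinner_scaleC_right norm_mult
        selfadjoint_commute[OF H, of u x])
  also have "\<dots> \<le> cmod a * (\<epsilon> * norm u)" using cross by (simp add: mult_left_mono)
  finally have "- (\<epsilon> * (norm u * cmod a)) \<le> Re (cinner u (H (a *\<^sub>C x)))"
    using abs_Re_le_cmod[of "cinner u (H (a *\<^sub>C x))"] by (simp add: mult_ac)
  moreover have "\<epsilon> * (2 * (norm u * cmod a)) \<le> \<epsilon> * ((norm u)\<^sup>2 + (cmod a)\<^sup>2)"
    using sum_squares_bound[of "norm u" "cmod a"] \<epsilon> by (intro mult_left_mono) simp_all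
  moreover have "(cmod a)\<^sup>2 * (s - \<epsilon>) \<le> qform H (a *\<^sub>C x)"
    unfolding qform_scaleC[OF Hb] using qx by (intro mult_left_mono) simp_all
  ultimately show ?thesis
    using u unfolding qform_add[OF H, of u "a *\<^sub>C x"] norm by (simp add: algebra_simps)
qed

text \<open>The approximate substitute for the top \<open>r\<close> eigenvectors of \<open>H\<close>: their span almost decouples from
  its orthogonal complement, and on it the form almost dominates the supremum \<open>s\<close> of the form on the
  complement.  Each new vector \<open>x\<close> almost attains the current supremum, up to \<open>\<delta>\<close>.
  Cauchy--Schwarz for \<open>s - H\<close> then bounds its interaction with the remaining complement by
  \<open>sqrt (\<delta> C)\<close>, where \<open>C\<close> is a bound for \<open>s - H\<close>; this dictates the choice
  of \<open>\<delta>\<close>.  Each step doubles the error, so the previous family is built for \<open>\<epsilon> / 2\<close>.\<close>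

lemma almost_maximal_orthonormal_family:
  fixes H :: "'a::complex_hilbert_space \<Rightarrow> 'a"
  assumes H: "selfadjoint H" and "orthonormal (Suc r) (e0 :: nat \<Rightarrow> 'a)" and "0 < \<epsilon>"
  shows "\<exists>v s. orthonormal r v
     \<and> (\<forall>u \<in> fspan r v. \<forall>w \<in> fperp r v. cmod (cinner w (H u)) \<le> \<epsilon> * norm u * norm w)
     \<and> (\<forall>u \<in> fspan r v. (s - \<epsilon>) * (norm u)\<^sup>2 \<le> qform H u)
     \<and> (\<forall>w \<in> fperp r v. qform H w \<le> s * (norm w)\<^sup>2)
     \<and> (\<forall>\<delta>>0. \<exists>w \<in> fperp r v. norm w = 1 \<and> s - \<delta> < qform H w)"
  using assms(2,3)
proof (induction r arbitrary: \<epsilon>)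
  case 0
  have Hb: "bounded_clinear H" using H by (rule selfadjoint_bounded_clinear)
  obtain s where "\<And>w. w \<in> fperp 0 e0 \<Longrightarrow> qform H w \<le> s * (norm w)\<^sup>2"
    "\<And>\<delta>. \<delta> > 0 \<Longrightarrow> \<exists>w \<in> fperp 0 e0. norm w = 1 \<and> s - \<delta> < qform H w"
    using qform_sup_on_fperp[OF Hb "0.prems"(1)] by blast
  moreover have "fspan 0 e0 = {0}" by simp
  ultimately show ?case
    by (intro exI[of _ e0] exI[of _ s])
      (simp add: orthonormal_def qform_def bounded_clinear_zero[OF Hb])
next
  case (Suc r)
  have Hb: "bounded_clinear H" using H by (rule selfadjoint_bounded_clinear)
  define \<epsilon>' where "\<epsilon>' = \<epsilon> / 2"
  have \<epsilon>': "0 < \<epsilon>'" using Suc.prems by (simp add: \<epsilon>'_def)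
  have "orthonormal (Suc r) e0" using Suc.prems(1) by (rule orthonormal_mono) simp
  from Suc.IH[OF this \<epsilon>'] obtain v s where v: "orthonormal r v"
    and cross: "\<And>u w. u \<in> fspan r v \<Longrightarrow> w \<in> fperp r v \<Longrightarrow>
          cmod (cinner w (H u)) \<le> \<epsilon>' * norm u * norm w"
    and low: "\<And>u. u \<in> fspan r v \<Longrightarrow> (s - \<epsilon>') * (norm u)\<^sup>2 \<le> qform H u"
    and up: "\<And>w. w \<in> fperp r v \<Longrightarrow> qform H w \<le> s * (norm w)\<^sup>2"
    and sup: "\<And>\<delta>. \<delta> > 0 \<Longrightarrow> \<exists>w \<in> fperp r v. norm w = 1 \<and> s - \<delta> < qform H w"
    by blast
  define C where "C = \<bar>s\<bar> + onorm H + 1"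
  have C: "0 < C" using Hb onorm_pos_le[of H] by (simp add: C_def bounded_clinear_def)
  define \<delta> where "\<delta> = min \<epsilon>' (\<epsilon>'\<^sup>2 / C)"
  have "0 < \<delta>" using \<epsilon>' C by (simp add: \<delta>_def)
  then obtain x where x: "x \<in> fperp r v" "norm x = 1" "s - \<delta> < qform H x" using sup by blast
  define v' where "v' = v(r := x)"
  have v': "orthonormal (Suc r) v'"
    unfolding v'_def using v x(1,2) by (intro orthonormal_snoc) (auto simp: fperp_def)
  obtain s' where up': "\<And>w. w \<in> fperp (Suc r) v' \<Longrightarrow> qform H w \<le> s' * (norm w)\<^sup>2"
    and sup': "\<And>\<delta>. \<delta> > 0 \<Longrightarrow> \<exists>w \<in> fperp (Suc r) v'. norm w = 1 \<and> s' - \<delta> < qform H w"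
    using qform_sup_on_fperp[OF Hb Suc.prems(1)] by blast
  have perp: "w \<in> fperp r v" "cinner x w = 0" if "w \<in> fperp (Suc r) v'" for w
    using that by (auto simp: fperp_def v'_def less_Suc_eq)
  have "s' \<le> s"
  proof (rule field_le_epsilon)
    fix d :: real assume "0 < d"
    then obtain w where w: "w \<in> fperp (Suc r) v'" "norm w = 1" "s' - d < qform H w"
      using sup' by blast
    then show "s' \<le> s + d" using up[OF perp(1)[OF w(1)]] by simp
  qed
  have xcross: "cmod (cinner w (H x)) \<le> \<epsilon>' * norm w" if w: "w \<in> fperp (Suc r) v'" for w
  proof -
    let ?G = "\<lambda>x. s *\<^sub>R x + (- 1) *\<^sub>R H x"
    have psd: "0 \<le> qform ?G y" if "y \<in> fperp r v" for y
      unfolding qform_shift using up[OF that] by simp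
    have "cinner w x = 0" using perp(2)[OF w] cinner_eq_zero_sym by blast
    then have "(cmod (cinner w (H x)))\<^sup>2 = (cmod (cinner w (?G x)))\<^sup>2"
      by (simp add: cinner_add_right cinner_diff_right)
    also have "\<dots> \<le> qform ?G x * qform ?G w"
      by (rule psd_cauchy_schwarz[OF selfadjoint_shift[OF H]])
        (use x(1) perp(1)[OF w] in \<open>blast intro: psd fperp_add_scaleC\<close>)+
    also have "\<dots> \<le> \<delta> * (C * (norm w)\<^sup>2)"
    proof (rule mult_mono)
      show "qform ?G x \<le> \<delta>" unfolding qform_shift using x(2,3) by simp
      have "s * (norm w)\<^sup>2 \<le> \<bar>s\<bar> * (norm w)\<^sup>2" by (intro mult_right_mono) simp_all
      then show "qform ?G w \<le> C * (norm w)\<^sup>2"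
        unfolding qform_shift C_def distrib_right
        using abs_qform_le[OF Hb, of w] zero_le_power2[of "norm w"] by linarith
      show "0 \<le> qform ?G w" using psd[OF perp(1)[OF w]] .
    qed (use \<open>0 < \<delta>\<close> in simp)
    also have "\<dots> = (\<delta> * C) * (norm w)\<^sup>2" by simp
    also have "\<dots> \<le> \<epsilon>'\<^sup>2 * (norm w)\<^sup>2"
    proof (rule mult_right_mono)
      have "\<delta> \<le> \<epsilon>'\<^sup>2 / C" by (simp add: \<delta>_def)
      then show "\<delta> * C \<le> \<epsilon>'\<^sup>2" using C by (simp add: field_simps)
    qed simp
    finally show ?thesis
      using \<epsilon>' by (simp add: power_mult_distrib[symmetric] power2_le_iff_abs_le)
  qed
  have low': "(s' - \<epsilon>) * (norm y)\<^sup>2 \<le> qform H y" if y: "y \<in> fspan (Suc r) v'" for y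
  proof -
    obtain u a where u: "u \<in> fspan r v" "y = u + a *\<^sub>C x"
      using y unfolding v'_def by (rule mem_fspan_snoc)
    have "(s - 2 * \<epsilon>') * (norm y)\<^sup>2 \<le> qform H y"
      unfolding u(2)
    proof (rule qform_ge_on_orthogonal_sum[OF H x(2)])
      show "cinner u x = 0" using u(1) x(1) by (rule fspan_fperp_orthogonal)
      show "cmod (cinner x (H u)) \<le> \<epsilon>' * norm u" using cross[OF u(1) x(1)] x(2) by simp
      show "s - \<epsilon>' \<le> qform H x" using x(3) by (simp add: \<delta>_def)
    qed (use \<epsilon>' low[OF u(1)] in simp_all)
    moreover have "(s' - \<epsilon>) * (norm y)\<^sup>2 \<le> (s - 2 * \<epsilon>') * (norm y)\<^sup>2"
      using \<open>s' \<le> s\<close> by (intro mult_right_mono) (simp_all add: \<epsilon>'_def)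
    ultimately show ?thesis by simp
  qed
  have cross': "cmod (cinner w (H y)) \<le> \<epsilon> * norm y * norm w"
    if y: "y \<in> fspan (Suc r) v'" and w: "w \<in> fperp (Suc r) v'" for y w
  proof -
    obtain u a where u: "u \<in> fspan r v" "y = u + a *\<^sub>C x"
      using y unfolding v'_def by (rule mem_fspan_snoc)
    have "(norm y)\<^sup>2 = (norm u)\<^sup>2 + (cmod a)\<^sup>2"
      using pythagoras[of u "a *\<^sub>C x"] fspan_fperp_orthogonal[OF u(1) x(1)] x(2) u(2)
      by (simp add: cinner_scaleC_right norm_scaleC)
    then have le: "norm u \<le> norm y" "cmod a \<le> norm y"
      by (simp_all add: power2_le_imp_le)
    have "cinner w (H y) = cinner w (H u) + a * cinner w (H x)"
      unfolding u(2) bounded_clinear_add[OF Hb] bounded_clinear_scaleC[OF Hb]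
      by (simp add: cinner_add_right cinner_scaleC_right)
    then have "cmod (cinner w (H y)) \<le> cmod (cinner w (H u)) + cmod a * cmod (cinner w (H x))"
      by (metis norm_mult norm_triangle_ineq)
    also have "\<dots> \<le> \<epsilon>' * norm u * norm w + cmod a * (\<epsilon>' * norm w)"
      using cross[OF u(1) perp(1)[OF w]] xcross[OF w] by (intro add_mono mult_left_mono) simp_all
    also have "\<dots> \<le> \<epsilon>' * norm y * norm w + norm y * (\<epsilon>' * norm w)"
      using le \<epsilon>' by (intro add_mono mult_right_mono mult_left_mono) simp_all
    finally show ?thesis by (simp add: \<epsilon>'_def mult_ac)
  qed
  show ?case using v' cross' low' up' sup' by blast
qed

text \<open>Subtracting \<open>2 N\<close> times the projection pushes the form on the almost maximal directions to at
  most \<open>- N\<close>, hence to at most \<open>s\<close>, so the perturbed form is at most \<open>s + \<epsilon>\<close> everywhere.  On the other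
  hand \<open>s\<close> hardly exceeds \<open>lambda_op (Suc r) H\<close>: adjoining to the family a vector of the complement
  that almost attains \<open>s\<close> gives a subspace of dimension \<open>r + 1\<close> on which the form of \<open>H\<close> is
  almost at least \<open>s\<close>.  The perturbed operator enters only through its form, which frees the
  statement from a particular expression for it.\<close>

lemma deflation_by_projection:
  fixes H :: "'a::complex_hilbert_space \<Rightarrow> 'a"
  assumes H: "selfadjoint H" and N: "\<And>x. \<bar>qform H x\<bar> \<le> N * (norm x)\<^sup>2"
    and ex: "orthonormal (Suc r) (e0 :: nat \<Rightarrow> 'a)" and \<epsilon>: "0 < \<epsilon>"
  shows "\<exists>v. orthonormal r v \<and> (\<forall>H'. selfadjoint H' \<longrightarrow>
      (\<forall>x. qform H' x = qform H x - 2 * N * qform (fproj r v) x) \<longrightarrow>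
      lambda_op 1 H' \<le> lambda_op (Suc r) H + \<epsilon>)"
proof -
  define \<epsilon>' where "\<epsilon>' = \<epsilon> / 3"
  have \<epsilon>': "0 < \<epsilon>'" using \<epsilon> by (simp add: \<epsilon>'_def)
  obtain v s where v: "orthonormal r v"
    and cross: "\<And>u w. u \<in> fspan r v \<Longrightarrow> w \<in> fperp r v \<Longrightarrow>
          cmod (cinner w (H u)) \<le> \<epsilon>' * norm u * norm w"
    and low: "\<And>u. u \<in> fspan r v \<Longrightarrow> (s - \<epsilon>') * (norm u)\<^sup>2 \<le> qform H u"
    and up: "\<And>w. w \<in> fperp r v \<Longrightarrow> qform H w \<le> s * (norm w)\<^sup>2"
    and sup: "\<And>\<delta>. \<delta> > 0 \<Longrightarrow> \<exists>w \<in> fperp r v. norm w = 1 \<and> s - \<delta> < qform H w"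
    using almost_maximal_orthonormal_family[OF H ex \<epsilon>'] by blast
  obtain x where x: "x \<in> fperp r v" "norm x = 1" "s - \<epsilon>' < qform H x" using sup[OF \<epsilon>'] by blast
  have "- N \<le> s" using up[OF x(1)] N[of x] x(2) by simp
  have lower: "s - 2 * \<epsilon>' \<le> lambda_op (Suc r) H"
  proof (rule lambda_op_ge[OF H])
    show "orthonormal (Suc r) (v(r := x))"
      using v x(1,2) by (intro orthonormal_snoc) (auto simp: fperp_def)
    fix y assume "y \<in> fspan (Suc r) (v(r := x))"
    then obtain u a where u: "u \<in> fspan r v" "y = u + a *\<^sub>C x" by (rule mem_fspan_snoc)
    show "(s - 2 * \<epsilon>') * (norm y)\<^sup>2 \<le> qform H y"
      unfolding u(2)
    proof (rule qform_ge_on_orthogonal_sum[OF H x(2)])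
      show "cinner u x = 0" using u(1) x(1) by (rule fspan_fperp_orthogonal)
      show "cmod (cinner x (H u)) \<le> \<epsilon>' * norm u" using cross[OF u(1) x(1)] x(2) by simp
    qed (use \<epsilon>' low[OF u(1)] x(3) in simp_all)
  qed simp
  have "lambda_op 1 H' \<le> lambda_op (Suc r) H + \<epsilon>"
    if H': "selfadjoint H'" and q: "\<And>x. qform H' x = qform H x - 2 * N * qform (fproj r v) x" for H'
  proof -
    have upper: "qform H' y \<le> (s + \<epsilon>') * (norm y)\<^sup>2" for y
    proof -
      define u where "u = fproj r v y"
      define w where "w = y - u"
      have y: "y = w + u" by (simp add: w_def)
      have u: "u \<in> fspan r v" unfolding u_def by (rule fproj_mem)
      have w: "w \<in> fperp r v" by (simp add: w_def u_def fperp_def fproj_residual[OF v])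
      have "cinner w u = 0" using fspan_fperp_orthogonal[OF u w] cinner_eq_zero_sym by blast
      then have norm: "(norm y)\<^sup>2 = (norm w)\<^sup>2 + (norm u)\<^sup>2" unfolding y by (rule pythagoras)
      have "Re (cinner w (H u)) \<le> \<epsilon>' * norm u * norm w"
        using cross[OF u w] complex_Re_le_cmod order_trans by blast
      moreover have "\<epsilon>' * (2 * (norm u * norm w)) \<le> \<epsilon>' * ((norm u)\<^sup>2 + (norm w)\<^sup>2)"
        using sum_squares_bound[of "norm u" "norm w"] \<epsilon>' by (intro mult_left_mono) simp_all
      moreover have "qform H' y = qform H w + 2 * Re (cinner w (H u)) + qform H u - 2 * N * (norm u)\<^sup>2"
        unfolding q[of y] qform_fproj[OF v] u_def[symmetric] by (subst y) (simp add: qform_add[OF H])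
      moreover have "qform H u \<le> N * (norm u)\<^sup>2" using N[of u] by simp
      moreover have "- N * (norm u)\<^sup>2 \<le> s * (norm u)\<^sup>2"
        using \<open>- N \<le> s\<close> by (intro mult_right_mono) simp_all
      ultimately show ?thesis using up[OF w] unfolding norm by (simp add: algebra_simps)
    qed
    have "orthonormal 1 e0" using ex by (rule orthonormal_mono) simp
    then have "lambda_op 1 H' \<le> s + \<epsilon>'"
    proof (rule lambda_op_le[OF H' order_refl])
      fix e c assume e: "orthonormal 1 e" and c: "\<And>x. x \<in> fspan 1 e \<Longrightarrow> c * (norm x)\<^sup>2 \<le> qform H' x"
      have "c * (norm (e 0))\<^sup>2 \<le> qform H' (e 0)" by (rule c[OF fspan_mem]) simp
      also have "\<dots> \<le> (s + \<epsilon>') * (norm (e 0))\<^sup>2" by (rule upper)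
      finally show "c \<le> s + \<epsilon>'" using orthonormal_norm[OF e, of 0] by simp
    qed
    then show ?thesis using lower by (simp add: \<epsilon>'_def)
  qed
  then show ?thesis using v by blast
qed

section \<open>The rank reduction theorem\<close>

lemma qform_rotated_perturbation:
  "qform (\<lambda>x. cis \<eta> *\<^sub>C (A x + (2 * cis \<xi> * complex_of_real N) *\<^sub>C P x)) x
     = qform (\<lambda>x. cis \<eta> *\<^sub>C A x) x + 2 * N * Re (cis (\<eta> + \<xi>) * cinner x (P x))"
proof -
  have "cis \<eta> * (cinner x (A x) + (2 * cis \<xi> * complex_of_real N) * cinner x (P x))
      = cis \<eta> * cinner x (A x) + complex_of_real (2 * N) * (cis (\<eta> + \<xi>) * cinner x (P x))"
    by (simp add: algebra_simps cis_mult[symmetric])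
  then show ?thesis
    by (simp add: qform_def cinner_scaleC_right cinner_add_right del: times_complex.sel of_real_mult)
      (simp only: Re_complex_of_real mult.assoc plus_complex.sel flip: of_real_mult, simp)
qed

lemma abs_qform_rotated_le:
  assumes "bounded_clinear A"
  shows "\<bar>qform (\<lambda>x. cis \<eta> *\<^sub>C A x) x\<bar> \<le> onorm A * (norm x)\<^sup>2"
proof -
  have "\<bar>qform (\<lambda>x. cis \<eta> *\<^sub>C A x) x\<bar> \<le> cmod (cis \<eta> * cinner x (A x))"
    unfolding qform_def cinner_scaleC_right by (rule abs_Re_le_cmod)
  also have "\<dots> \<le> norm x * norm (A x)" using cauchy_schwarz[of x "A x"] by (simp add: norm_mult)
  also have "\<dots> \<le> norm x * (onorm A * norm x)"
    using bounded_clinear_bound[OF assms] by (simp add: mult_left_mono)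
  finally show ?thesis by (simp add: power2_eq_square mult_ac)
qed

lemma bounded_clinear_rotated_perturbation:
  "bounded_clinear A \<Longrightarrow> bounded_clinear P \<Longrightarrow> bounded_clinear (\<lambda>x. z *\<^sub>C (A x + c *\<^sub>C P x))"
  by (intro bounded_clinear_scaleC_comp bounded_clinear_plus_scaleC)

lemma mem_Omega_iff:
  "\<mu> \<in> Omega m B \<longleftrightarrow>
     (\<forall>\<eta> \<in> {0..<2 * pi}. Re (cis \<eta> * \<mu>) \<le> lambda_op m (Re_op (\<lambda>x. cis \<eta> *\<^sub>C B x)))"
  unfolding Omega_def by blast

lemma Omega_subset_Omega_perturbed:
  fixes A :: "'a::complex_hilbert_space \<Rightarrow> 'a"
  assumes A: "bounded_clinear A" and m: "m \<ge> 1"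
    and ex: "orthonormal (r + m) (e0 :: nat \<Rightarrow> 'a)" and P: "P \<in> projections r"
  shows "Omega (r + m) A \<subseteq> Omega m (\<lambda>x. A x + c *\<^sub>C P x)"
proof
  fix \<mu> assume \<mu>: "\<mu> \<in> Omega (r + m) A"
  have Pb: "bounded_clinear P" using P by (simp add: projections_def)
  obtain f where f: "\<And>x. (\<And>i. i < r \<Longrightarrow> cinner (f i) x = 0) \<Longrightarrow> P x = 0"
    using projection_kernel_equations[OF P] by blast
  have le: "lambda_op (r + m) (Re_op (\<lambda>x. cis \<eta> *\<^sub>C A x))
      \<le> lambda_op m (Re_op (\<lambda>x. cis \<eta> *\<^sub>C (A x + c *\<^sub>C P x)))" for \<eta>
  proof (rule lambda_op_le_lambda_op_drop[OF _ _ m ex])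
    fix x assume "\<And>i. i < r \<Longrightarrow> cinner (f i) x = 0"
    then have "P x = 0" by (rule f)
    then show "qform (Re_op (\<lambda>x. cis \<eta> *\<^sub>C A x)) x
        \<le> qform (Re_op (\<lambda>x. cis \<eta> *\<^sub>C (A x + c *\<^sub>C P x))) x"
      unfolding qform_Re_op[OF bounded_clinear_scaleC_comp[OF A]]
        qform_Re_op[OF bounded_clinear_rotated_perturbation[OF A Pb]]
      by (simp add: qform_def)
  qed (intro selfadjoint_Re_op bounded_clinear_scaleC_comp[OF A]
      bounded_clinear_rotated_perturbation[OF A Pb])+
  show "\<mu> \<in> Omega m (\<lambda>x. A x + c *\<^sub>C P x)"
    using \<mu> order_trans[OF _ le] unfolding mem_Omega_iff by blast
qed

lemma exists_opposite_angle:
  assumes "\<eta> \<in> {0..<2 * pi}"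
  obtains \<xi> where "\<xi> \<in> {0..<2 * pi}" "cis (\<eta> + \<xi>) = -1"
proof (cases "\<eta> \<le> pi")
  case True
  then show ?thesis using assms that[of "pi - \<eta>"] by (auto simp: complex_eq_iff)
next
  case False
  have "cis (\<eta> + (3 * pi - \<eta>)) = cis pi * cis (2 * pi)" unfolding cis_mult by simp
  then have "cis (\<eta> + (3 * pi - \<eta>)) = -1" by simp
  then show ?thesis using assms False by (intro that[of "3 * pi - \<eta>"]) auto
qed

text \<open>The projections onto the first vector and onto all vectors of the same almost maximal family both
  separate \<open>\<mu>\<close>.  They agree on the orthogonal complement of the other \<open>n\<close> vectors, so the rank one
  case follows from the rank \<open>n + 1\<close> case by the dimension count.\<close>

lemma separating_perturbations:
  fixes A :: "'a::complex_hilbert_space \<Rightarrow> 'a"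
  assumes A: "bounded_clinear A" and ex: "orthonormal (Suc (Suc n)) (e0 :: nat \<Rightarrow> 'a)"
    and \<mu>: "\<mu> \<notin> Omega (Suc (Suc n)) A"
  obtains \<xi> v where "\<xi> \<in> {0..<2 * pi}" "orthonormal (Suc n) v"
    "\<mu> \<notin> Omega 1 (\<lambda>x. A x + (2 * cis \<xi> * complex_of_real (onorm A)) *\<^sub>C fproj (Suc n) v x)"
    "\<mu> \<notin> Omega (Suc n) (\<lambda>x. A x + (2 * cis \<xi> * complex_of_real (onorm A)) *\<^sub>C fproj 1 v x)"
proof -
  obtain \<eta> where \<eta>: "\<eta> \<in> {0..<2 * pi}"
    and gt: "lambda_op (Suc (Suc n)) (Re_op (\<lambda>x. cis \<eta> *\<^sub>C A x)) < Re (cis \<eta> * \<mu>)"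
    using \<mu> unfolding mem_Omega_iff not_le[symmetric] by blast
  obtain \<xi> where \<xi>: "\<xi> \<in> {0..<2 * pi}" "cis (\<eta> + \<xi>) = -1" using \<eta> by (rule exists_opposite_angle)
  let ?H = "Re_op (\<lambda>x. cis \<eta> *\<^sub>C A x)"
  let ?B = "\<lambda>P x. A x + (2 * cis \<xi> * complex_of_real (onorm A)) *\<^sub>C P x"
  let ?H' = "\<lambda>P. Re_op (\<lambda>x. cis \<eta> *\<^sub>C ?B P x)"
  have Ab: "bounded_clinear (\<lambda>x. cis \<eta> *\<^sub>C A x)" by (rule bounded_clinear_scaleC_comp[OF A])
  have H: "selfadjoint ?H" by (rule selfadjoint_Re_op[OF Ab])
  have H': "selfadjoint (?H' (fproj m v))" for m v
    by (rule selfadjoint_Re_op[OF bounded_clinear_rotated_perturbation[OF A fproj_bounded_clinear]])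
  have q': "qform (?H' (fproj m v)) x = qform ?H x - 2 * onorm A * qform (fproj m v) x" for m v x
    unfolding qform_Re_op[OF Ab] qform_rotated_perturbation \<xi>(2)
      qform_Re_op[OF bounded_clinear_rotated_perturbation[OF A fproj_bounded_clinear]]
    by (simp add: qform_def)
  define \<epsilon> where "\<epsilon> = (Re (cis \<eta> * \<mu>) - lambda_op (Suc (Suc n)) ?H) / 2"
  have "0 < \<epsilon>" using gt by (simp add: \<epsilon>_def)
  have bound: "\<bar>qform ?H x\<bar> \<le> onorm A * (norm x)\<^sup>2" for x
    unfolding qform_Re_op[OF Ab] by (rule abs_qform_rotated_le[OF A])
  obtain v where v: "orthonormal (Suc n) v"
    and defl: "\<And>H'. selfadjoint H' \<Longrightarrow>
      (\<And>x. qform H' x = qform ?H x - 2 * onorm A * qform (fproj (Suc n) v) x) \<Longrightarrow>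
      lambda_op 1 H' \<le> lambda_op (Suc (Suc n)) ?H + \<epsilon>"
    using deflation_by_projection[OF H bound ex \<open>0 < \<epsilon>\<close>] by blast
  have "lambda_op 1 (?H' (fproj (Suc n) v)) \<le> lambda_op (Suc (Suc n)) ?H + \<epsilon>"
    by (rule defl[OF H' q'])
  then have 1: "lambda_op 1 (?H' (fproj (Suc n) v)) < Re (cis \<eta> * \<mu>)"
    using gt unfolding \<epsilon>_def by argo
  have "lambda_op (n + 1) (?H' (fproj 1 v)) \<le> lambda_op 1 (?H' (fproj (Suc n) v))"
  proof (rule lambda_op_le_lambda_op_drop[OF H' H' order_refl])
    show "orthonormal (n + 1) v" using v by simp
    fix x assume "\<And>i. i < n \<Longrightarrow> cinner (v (Suc i)) x = 0"
    then have "fproj (Suc n) v x = fproj 1 v x"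
      unfolding fproj_def by (subst sum.lessThan_Suc_shift) simp
    then show "qform (?H' (fproj 1 v)) x \<le> qform (?H' (fproj (Suc n) v)) x"
      unfolding q' by (simp add: qform_def)
  qed
  with 1 have 2: "lambda_op (Suc n) (?H' (fproj 1 v)) < Re (cis \<eta> * \<mu>)" by simp
  show ?thesis
  proof (rule that[OF \<xi>(1) v])
    show "\<mu> \<notin> Omega 1 (?B (fproj (Suc n) v))" using 1 \<eta> unfolding mem_Omega_iff by (meson not_le)
    show "\<mu> \<notin> Omega (Suc n) (?B (fproj 1 v))" using 2 \<eta> unfolding mem_Omega_iff by (meson not_le)
  qed
qed

theorem corollary3p3:
  fixes A :: "'a::complex_hilbert_space \<Rightarrow> 'a"
    and k :: nat
  assumes "bounded_clinear A"
    and "k \<ge> 2"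
    and "cdim_ge TYPE('a) k"
  shows "(\<Inter>\<xi> \<in> {0..<2 * pi}. \<Inter>P \<in> projections 1.
            Omega (k - 1) (\<lambda>x. A x + (2 * cis \<xi> * complex_of_real (onorm A)) *\<^sub>C P x))
         = Omega k A \<and>
         (\<Inter>\<xi> \<in> {0..<2 * pi}. \<Inter>P \<in> projections (k - 1).
            Omega 1 (\<lambda>x. A x + (2 * cis \<xi> * complex_of_real (onorm A)) *\<^sub>C P x))
         = Omega k A"
proof -
  define n where "n = k - 2"
  have k: "k = Suc (Suc n)" using assms(2) by (simp add: n_def)
  obtain e0 :: "nat \<Rightarrow> 'a" where e0: "orthonormal k e0" using assms(3) by (rule cdim_ge_orthonormal)
  let ?B = "\<lambda>\<xi> P x. A x + (2 * cis \<xi> * complex_of_real (onorm A)) *\<^sub>C P x"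
  let ?a = "\<Inter>\<xi> \<in> {0..<2 * pi}. \<Inter>P \<in> projections 1. Omega (k - 1) (?B \<xi> P)"
  let ?b = "\<Inter>\<xi> \<in> {0..<2 * pi}. \<Inter>P \<in> projections (k - 1). Omega 1 (?B \<xi> P)"
  have "Omega k A \<subseteq> Omega (k - 1) (?B \<xi> P)" if "P \<in> projections 1" for \<xi> and P :: "'a \<Rightarrow> 'a"
    using Omega_subset_Omega_perturbed[OF assms(1) _ _ that, of "k - 1" e0] e0 k by simp
  then have a: "Omega k A \<subseteq> ?a" by blast
  have "Omega k A \<subseteq> Omega 1 (?B \<xi> P)" if "P \<in> projections (k - 1)" for \<xi> and P :: "'a \<Rightarrow> 'a"
    using Omega_subset_Omega_perturbed[OF assms(1) _ _ that, of 1 e0] e0 k by simp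
  then have b: "Omega k A \<subseteq> ?b" by blast
  have "\<mu> \<notin> ?a \<and> \<mu> \<notin> ?b" if \<mu>: "\<mu> \<notin> Omega k A" for \<mu>
  proof -
    obtain \<xi> v where \<xi>: "\<xi> \<in> {0..<2 * pi}" and v: "orthonormal (Suc n) v"
      and 1: "\<mu> \<notin> Omega 1 (?B \<xi> (fproj (Suc n) v))" and 2: "\<mu> \<notin> Omega (Suc n) (?B \<xi> (fproj 1 v))"
      using separating_perturbations[OF assms(1) e0[unfolded k] \<mu>[unfolded k]] by blast
    have "fproj (Suc n) v \<in> projections (k - 1)" using fproj_in_projections[OF v] k by simp
    moreover have "fproj 1 v \<in> projections 1"
      using v by (intro fproj_in_projections) (auto intro: orthonormal_mono)
    moreover have "k - 1 = Suc n" using k by simp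
    ultimately show ?thesis using \<xi> 1 2 by auto
  qed
  then show ?thesis using a b by blast
qed

end
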